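(* Let $\lambda\in\mathcal D$ with equilibrium $\theta$ and $q=-\lambda'$, let $\sigma>0$, and suppose the limit $$\kappa_\infty:=\lim_{|y|\to\infty}\frac{q(\theta+y)}{y^2}$$ exists (through both tails) in $(0,\infty)$. Then for every $x\in\mathbb R$ and $T>0$, $$\kappa_\infty\sigma^2T^2<\pi^2\ \Longrightarrow\ \mathcal N_{1/2}(T,x)<\infty,\qquad\kappa_\infty\sigma^2T^2>\pi^2\ \Longrightarrow\ \mathcal N_{1/2}(T,x)=\infty.$$
   Context: Class $\mathcal D$: all $\lambda\in C^1(\mathbb R)$ that are strictly decreasing with $\lambda(\theta)=0$ for some (unique) $\theta\in\mathbb R$, called the equilibrium. For $\lambda\in\mathcal D$ the SDE $\mathrm dX_t=\lambda(X_t)\,\mathrm dt+\sigma\,\mathrm dW_t$, $X_0=x$ ($W$ a standard Brownian motion) has a unique non-explosive strong solution, and $$\mathcal N_{1/2}(T,x):=\mathbb E_x\Big[\exp\Big\{\frac12\int_0^T\frac{\lambda(X_s)^2}{\sigma^2}\,\mathrm ds\Big\}\Big]\in[1,\infty].$$ *)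

theory Defs
  imports "HOL-Probability.Probability"
begin

definition class_D :: "(real \<Rightarrow> real) set" where
  "class_D = {lam. lam C1_differentiable_on UNIV \<and>
                   (\<forall>x y. x < y \<longrightarrow> lam y < lam x) \<and>
                   (\<exists>\<theta>. lam \<theta> = 0)}"

definition equilibrium :: "(real \<Rightarrow> real) \<Rightarrow> real \<Rightarrow> bool" where
  "equilibrium lam \<theta> \<longleftrightarrow> lam \<theta> = 0"

(* Processes have time set [0, \<infinity>); they are represented as functions on all of real, and their
   values at negative times are irrelevant.  A filtration on [0, \<infinity>) is thought of as extended
   by F t = F 0 for t < 0, so that the library locale applies. *)

definition filtered_prob_space :: "'a measure \<Rightarrow> (real \<Rightarrow> 'a measure) \<Rightarrow> bool" where
  "filtered_prob_space M F \<longleftrightarrow>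
     prob_space M \<and> filtration (space M) F \<and> (\<forall>t. subalgebra M (F t))"

definition adapted_process :: "(real \<Rightarrow> 'a measure) \<Rightarrow> (real \<Rightarrow> 'a \<Rightarrow> real) \<Rightarrow> bool" where
  "adapted_process F X \<longleftrightarrow> (\<forall>t\<ge>0. X t \<in> borel_measurable (F t))"

definition continuous_paths :: "'a measure \<Rightarrow> (real \<Rightarrow> 'a \<Rightarrow> real) \<Rightarrow> bool" where
  "continuous_paths M X \<longleftrightarrow> (AE \<omega> in M. continuous_on {0..} (\<lambda>t. X t \<omega>))"

definition standard_brownian_motion ::
    "'a measure \<Rightarrow> (real \<Rightarrow> 'a measure) \<Rightarrow> (real \<Rightarrow> 'a \<Rightarrow> real) \<Rightarrow> bool" where
  "standard_brownian_motion M F W \<longleftrightarrow>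
     filtered_prob_space M F \<and>
     adapted_process F W \<and>
     continuous_paths M W \<and>
     (AE \<omega> in M. W 0 \<omega> = 0) \<and>
     (\<forall>s t. 0 \<le> s \<and> s < t \<longrightarrow>
        distributed M lborel (\<lambda>\<omega>. W t \<omega> - W s \<omega>) (normal_density 0 (sqrt (t - s))) \<and>
        prob_space.indep_set M (sets (F s))
          {(\<lambda>\<omega>. W t \<omega> - W s \<omega>) -` A \<inter> space M | A. A \<in> sets borel})"

(* X is a (global) solution of dX = lam(X) dt + \<sigma> dW with X 0 = x, driven by the given W.
   Since the noise is additive, the stochastic integral of the constant \<sigma> is \<sigma> * W t.  Along a
   continuous path the drift integrand is continuous for the coefficients lam considered here,
   so the gauge integral over {0..t} is the ordinary one. *)

definition sde_solution ::
    "'a measure \<Rightarrow> (real \<Rightarrow> 'a measure) \<Rightarrow> (real \<Rightarrow> 'a \<Rightarrow> real) \<Rightarrow>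
     (real \<Rightarrow> real) \<Rightarrow> real \<Rightarrow> real \<Rightarrow> (real \<Rightarrow> 'a \<Rightarrow> real) \<Rightarrow> bool" where
  "sde_solution M F W lam \<sigma> x X \<longleftrightarrow>
     standard_brownian_motion M F W \<and>
     adapted_process F X \<and>
     continuous_paths M X \<and>
     (AE \<omega> in M. X 0 \<omega> = x) \<and>
     (AE \<omega> in M. \<forall>t\<ge>0. X t \<omega> = x + integral {0..t} (\<lambda>s. lam (X s \<omega>)) + \<sigma> * W t \<omega>)"

(* The expectation E_x[exp(1/2 \<integral>_0^T lam(X_s)^2 / \<sigma>^2 ds)] in [0, \<infinity>]; the starting point x enters
   through the solution X. *)

definition novikov_half ::
    "'a measure \<Rightarrow> (real \<Rightarrow> real) \<Rightarrow> real \<Rightarrow> (real \<Rightarrow> 'a \<Rightarrow> real) \<Rightarrow> real \<Rightarrow> ennreal" where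
  "novikov_half M lam \<sigma> X T =
     (\<integral>\<^sup>+ \<omega>. ennreal (exp (1/2 * integral {0..T} (\<lambda>s. (lam (X s \<omega>))\<^sup>2 / \<sigma>\<^sup>2))) \<partial>M)"

end

theory Submission
  imports Defs
begin

text \<open>
  Let \<open>L' = lam\<close> and \<open>f t y = - L y / \<sigma>\<^sup>2 + a t * (y - \<theta>)\<^sup>2 / 2 + c t * (y - \<theta>)\<close>. Formally, by the
  Ito formula, \<open>exp (f T (X T) - f 0 x + 1/2 \<integral> lam(X)\<^sup>2 / \<sigma>\<^sup>2)\<close> is an exponential martingale times
  \<open>exp (\<integral> G t (X t))\<close> with \<open>G\<close> the generator term of \<open>f\<close>; the choice of the potential \<open>L\<close> cancels
  \<open>lam\<close> from \<open>G\<close> and leaves \<open>q / 2\<close> plus a quadratic form.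

  If \<open>\<kappa> \<sigma>\<^sup>2 T\<^sup>2 < pi\<^sup>2\<close>, a Riccati equation solved by a tangent on a time interval longer than \<open>T\<close>
  makes \<open>G\<close> bounded above (with \<open>c = 0\<close>), and the quartic growth of \<open>- L\<close> bounds \<open>f T\<close> from below, so
  the expectation is finite. If \<open>\<kappa> \<sigma>\<^sup>2 T\<^sup>2 > pi\<^sup>2\<close>, take \<open>a = 0\<close> and let \<open>c\<close> push the path along
  \<open>x + n sin (pi t / T)\<close>: under the tilted measure the path stays with probability bounded below in a
  tube of fixed radius, where the exponent is at least \<open>const * n\<^sup>2 - O(n)\<close>.

  Neither stochastic integrals nor Girsanov's theorem are needed: on a grid of mesh \<open>d\<close> the
  exponential martingale is replaced by the product of the likelihood ratios of
  \<open>N(g d, d / (1 - h d))\<close> against \<open>N(0, d)\<close>, evaluated at the Brownian increments, with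
  \<open>g = \<sigma> f\<^sub>y\<close> and \<open>h = \<sigma>\<^sup>2 f\<^sub>y\<^sub>y \<plusminus> 1\<close>. Such a product has expectation exactly 1, the parameter \<open>h\<close>
  takes care of the second order term of the Taylor expansion, and the limit \<open>d \<rightarrow> 0\<close> is taken with
  Fatou's lemma only.
\<close>

section \<open>Gaussian likelihood ratios and Brownian increments\<close>

text \<open>The logarithm of the density of N(g d, d / (1 - h d)) relative to N(0, d) at the point
  z. To first order in d it is g z + h (z^2 - d) / 2 - g^2 d / 2, so \<open>g\<close> matches a
  first and \<open>h\<close> a second order Taylor coefficient.\<close>

definition log_tilt :: "real \<Rightarrow> real \<Rightarrow> real \<Rightarrow> real \<Rightarrow> real" where
  "log_tilt g h d z =
     ln (1 - h * d) / 2 + h * z\<^sup>2 / 2 + (1 - h * d) * g * z - (1 - h * d) * g\<^sup>2 * d / 2"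

lemma log_tilt_measurable [measurable (raw)]:
  assumes [measurable]: "g \<in> borel_measurable N" "h \<in> borel_measurable N" "z \<in> borel_measurable N"
  shows "(\<lambda>\<omega>. log_tilt (g \<omega>) (h \<omega>) d (z \<omega>)) \<in> borel_measurable N"
  unfolding log_tilt_def by measurable

text \<open>Completing the square in z: with a = 1 - h d the exponent becomes -(z - g d)^2 / (2 d /
  a), and the logarithmic term of \<open>log_tilt\<close> supplies the normalising factor sqrt
  a.\<close>

lemma log_tilt_density:
  assumes d: "d > 0" and hd: "h * d < 1"
  shows "normal_density 0 (sqrt d) z * exp (log_tilt g h d z) =
         normal_density (g * d) (sqrt (d / (1 - h * d))) z"
proof -
  define a where "a = 1 - h * d"
  have a: "a > 0" using hd by (simp add: a_def)
  have h: "h = (1 - a) / d" using d by (simp add: a_def)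
  have "exp (ln a / 2) = sqrt a"
    using a by (simp flip: ln_sqrt)
  moreover have "- z\<^sup>2 / (2 * d) + (h * z\<^sup>2 / 2 + a * g * z - a * g\<^sup>2 * d / 2)
      = - (z - g * d)\<^sup>2 / (2 * (d / a))"
    using d a unfolding h by (simp add: field_simps power2_eq_square)
  moreover have "log_tilt g h d z = ln a / 2 + (h * z\<^sup>2 / 2 + a * g * z - a * g\<^sup>2 * d / 2)"
    by (simp add: log_tilt_def a_def)
  then have "exp (- z\<^sup>2 / (2 * d)) * exp (log_tilt g h d z) =
      exp (ln a / 2) * exp (- z\<^sup>2 / (2 * d) + (h * z\<^sup>2 / 2 + a * g * z - a * g\<^sup>2 * d / 2))"
    by (simp only: exp_add mult_ac)
  ultimately have "exp (- z\<^sup>2 / (2 * d)) * exp (log_tilt g h d z) =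
      sqrt a * exp (- (z - g * d)\<^sup>2 / (2 * (d / a)))"
    by (simp only:)
  then show ?thesis
    using d a unfolding normal_density_def a_def[symmetric]
    by (simp add: real_sqrt_divide real_sqrt_mult field_simps)
qed

lemma nn_integral_tilt_density:
  assumes d: "d > 0" and hd: "h * d < 1"
  shows "(\<integral>\<^sup>+ z. ennreal (normal_density 0 (sqrt d) z) * ennreal (exp (log_tilt g h d z)) \<partial>lborel) = 1"
proof -
  have "(\<integral>\<^sup>+ z. ennreal (normal_density 0 (sqrt d) z) * ennreal (exp (log_tilt g h d z)) \<partial>lborel)
     = (\<integral>\<^sup>+ z. ennreal (normal_density (g * d) (sqrt (d / (1 - h * d))) z) \<partial>lborel)"
    by (simp add: log_tilt_density[OF d hd] flip: ennreal_mult')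
  also have "\<dots> = 1"
    using d hd by (simp add: nn_integral_eq_integral)
  finally show ?thesis .
qed

text \<open>Under the tilted Gaussian law z - g d is centred with variance d / (1 - h d), so the
  cross term of the square integrates to zero.\<close>

lemma nn_integral_tilt_second_moment:
  assumes d: "d > 0" and hd: "h * d < 1"
  shows "(\<integral>\<^sup>+ z. ennreal (normal_density 0 (sqrt d) z) *
            ennreal (exp (log_tilt g h d z) * (s + e * (z - g * d))\<^sup>2) \<partial>lborel)
         = ennreal (s\<^sup>2 + e\<^sup>2 * (d / (1 - h * d)))"
proof -
  let ?m = "g * d" and ?v = "sqrt (d / (1 - h * d))"
  have v: "?v > 0" using d hd by simp
  have v2: "?v\<^sup>2 = d / (1 - h * d)" using d hd by simp
  have 2: "has_bochner_integral lborel (\<lambda>z. normal_density ?m ?v z * (z - ?m)\<^sup>2) (d / (1 - h * d))"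
  proof -
    have "fact (2 * 1) / ((2 / ?v\<^sup>2) ^ 1 * fact 1) = ?v\<^sup>2" by (simp add: numeral_2_eq_2)
    then show ?thesis
      using normal_moment_even[OF v, of ?m 1] unfolding v2 by simp
  qed
  have 1: "has_bochner_integral lborel (\<lambda>z. normal_density ?m ?v z * (z - ?m)) 0"
    using normal_moment_odd[OF v, of ?m 0] by simp
  have 0: "has_bochner_integral lborel (\<lambda>z. normal_density ?m ?v z) 1"
    using normal_moment_even[OF v, of ?m 0] by simp
  have "has_bochner_integral lborel
     (\<lambda>z. s\<^sup>2 * normal_density ?m ?v z + (2 * s * e) * (normal_density ?m ?v z * (z - ?m))
        + e\<^sup>2 * (normal_density ?m ?v z * (z - ?m)\<^sup>2))
     (s\<^sup>2 * 1 + (2 * s * e) * 0 + e\<^sup>2 * (d / (1 - h * d)))"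
    by (intro has_bochner_integral_add has_bochner_integral_mult_right 0 1 2)
  also have "(\<lambda>z. s\<^sup>2 * normal_density ?m ?v z + (2 * s * e) * (normal_density ?m ?v z * (z - ?m))
        + e\<^sup>2 * (normal_density ?m ?v z * (z - ?m)\<^sup>2))
      = (\<lambda>z. normal_density ?m ?v z * (s + e * (z - ?m))\<^sup>2)"
    by (rule ext) algebra
  finally have *: "has_bochner_integral lborel (\<lambda>z. normal_density ?m ?v z * (s + e * (z - ?m))\<^sup>2)
      (s\<^sup>2 + e\<^sup>2 * (d / (1 - h * d)))" by simp
  have "(\<integral>\<^sup>+ z. ennreal (normal_density 0 (sqrt d) z) *
            ennreal (exp (log_tilt g h d z) * (s + e * (z - g * d))\<^sup>2) \<partial>lborel)
      = (\<integral>\<^sup>+ z. ennreal (normal_density ?m ?v z * (s + e * (z - ?m))\<^sup>2) \<partial>lborel)"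
    by (intro nn_integral_cong)
       (simp add: mult.assoc flip: ennreal_mult' log_tilt_density[OF d hd])
  also have "\<dots> = ennreal (s\<^sup>2 + e\<^sup>2 * (d / (1 - h * d)))"
    using * by (subst nn_integral_eq_integral)
      (auto simp: has_bochner_integral_iff)
  finally show ?thesis .
qed

text \<open>The square of a tilt is a tilt up to a constant factor: matching the coefficients of z^2
  and z forces the parameters 2 h and G with (1 - 2 h d) G = 2 (1 - h d) g, and the remainder is
  constant in z and of order d. The bound 1/4 keeps 1 - 2 h d at least 1/2.\<close>

lemma exp_log_tilt_squared:
  assumes "d > 0" and h: "\<bar>h\<bar> * d \<le> 1 / 4"
  shows "(exp (log_tilt g h d z))\<^sup>2 \<le>
     exp ((\<bar>h\<bar> + 3 * g\<^sup>2) * d) * exp (log_tilt (2 * (1 - h * d) * g / (1 - 2 * h * d)) (2 * h) d z)"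
proof -
  define u where "u = h * d"
  have u: "\<bar>u\<bar> \<le> 1 / 4" using assms by (simp add: u_def abs_mult)
  have u1: "1 - 2 * u > 0" "1 - u > 0" using u by auto
  define G where "G = 2 * (1 - u) * g / (1 - 2 * u)"
  have G: "(1 - 2 * u) * G = 2 * (1 - u) * g" using u1 by (simp add: G_def)
  \<comment> \<open>Since (1 - u)^2 = (1 - 2 u) + u^2, the first order terms in u cancel; this
    controls both G^2 and the difference of the logarithms.\<close>
  have sq: "(1 - u)\<^sup>2 / (1 - 2 * u) = 1 + u\<^sup>2 / (1 - 2 * u)"
    using u1 by (simp add: field_simps power2_eq_square)
  have "(1 - 2 * u) * G\<^sup>2 = 4 * ((1 - u)\<^sup>2 / (1 - 2 * u)) * g\<^sup>2"
    using u1 by (simp add: G_def power2_eq_square) algebra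
  also have "\<dots> = 4 * (1 + u\<^sup>2 / (1 - 2 * u)) * g\<^sup>2"
    unfolding sq ..
  also have "\<dots> \<le> 4 * (1 + 2 * u\<^sup>2) * g\<^sup>2"
  proof -
    have "u\<^sup>2 * 1 \<le> u\<^sup>2 * (2 * (1 - 2 * u))" using u by (intro mult_left_mono) auto
    then have "u\<^sup>2 / (1 - 2 * u) \<le> 2 * u\<^sup>2" using u1 by (simp add: pos_divide_le_eq algebra_simps)
    then show ?thesis by (intro mult_right_mono) auto
  qed
  finally have GG: "(1 - 2 * u) * G\<^sup>2 \<le> 4 * (1 + 2 * u\<^sup>2) * g\<^sup>2" .
  have usq: "u\<^sup>2 \<le> \<bar>u\<bar> / 4"
  proof -
    have "\<bar>u\<bar> * \<bar>u\<bar> \<le> \<bar>u\<bar> * (1 / 4)" using u by (intro mult_left_mono) auto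
    then show ?thesis by (simp add: power2_eq_square)
  qed
  have lnb: "ln (1 - u) - ln (1 - 2 * u) / 2 \<le> \<bar>u\<bar>"
  proof -
    have "2 * ln (1 - u) - ln (1 - 2 * u) = ln ((1 - u)\<^sup>2 / (1 - 2 * u))"
      using u1 by (simp add: ln_div ln_realpow)
    also note sq
    also have "ln (1 + u\<^sup>2 / (1 - 2 * u)) \<le> u\<^sup>2 / (1 - 2 * u)"
      using u1 by (intro ln_add_one_self_le_self) auto
    also have "\<dots> \<le> 2 * u\<^sup>2"
    proof -
      have "u\<^sup>2 * 1 \<le> u\<^sup>2 * (2 * (1 - 2 * u))" using u by (intro mult_left_mono) auto
      then show ?thesis using u1 by (simp add: pos_divide_le_eq algebra_simps)
    qed
    finally show ?thesis using usq by linarith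
  qed
  have "2 * log_tilt g h d z = log_tilt G (2 * h) d z
      + (ln (1 - u) - ln (1 - 2 * u) / 2) + ((1 - 2 * u) * G\<^sup>2 / 2 - (1 - u) * g\<^sup>2) * d"
  proof -
    have "log_tilt g h d z = ln (1 - u) / 2 + h * z\<^sup>2 / 2 + (1 - u) * g * z - (1 - u) * g\<^sup>2 * d / 2"
      by (simp add: log_tilt_def u_def)
    moreover have "log_tilt G (2 * h) d z =
        ln (1 - 2 * u) / 2 + h * z\<^sup>2 + 2 * (1 - u) * g * z - (1 - 2 * u) * G\<^sup>2 * d / 2"
      unfolding G[symmetric] by (simp add: log_tilt_def u_def mult.assoc)
    ultimately show ?thesis by (simp add: field_simps)
  qed
  moreover have "((1 - 2 * u) * G\<^sup>2 / 2 - (1 - u) * g\<^sup>2) * d \<le> 3 * g\<^sup>2 * d"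
  proof (rule mult_right_mono)
    have "2 * (1 + 2 * u\<^sup>2) * g\<^sup>2 - (1 - u) * g\<^sup>2 = (2 * (1 + 2 * u\<^sup>2) - (1 - u)) * g\<^sup>2"
      by algebra
    also have "\<dots> \<le> 3 * g\<^sup>2"
      using u usq by (intro mult_right_mono) auto
    finally have "2 * (1 + 2 * u\<^sup>2) * g\<^sup>2 - (1 - u) * g\<^sup>2 \<le> 3 * g\<^sup>2" .
    moreover have "(1 - 2 * u) * G\<^sup>2 / 2 \<le> 2 * (1 + 2 * u\<^sup>2) * g\<^sup>2" using GG by linarith
    ultimately show "(1 - 2 * u) * G\<^sup>2 / 2 - (1 - u) * g\<^sup>2 \<le> 3 * g\<^sup>2" by linarith
  qed (use assms in auto)
  moreover have "\<bar>u\<bar> = \<bar>h\<bar> * d" using assms by (simp add: u_def abs_mult)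
  ultimately have "2 * log_tilt g h d z \<le> (\<bar>h\<bar> + 3 * g\<^sup>2) * d + log_tilt G (2 * h) d z"
    using lnb by (simp add: algebra_simps)
  then have "exp (2 * log_tilt g h d z) \<le> exp ((\<bar>h\<bar> + 3 * g\<^sup>2) * d + log_tilt G (2 * h) d z)" by simp
  moreover have "exp (2 * log_tilt g h d z) = (exp (log_tilt g h d z))\<^sup>2" by (simp add: exp_double)
  ultimately show ?thesis
    by (simp add: exp_add G_def u_def mult.assoc)
qed

lemma nn_integral_tilt_squared:
  assumes d: "d > 0" and h: "\<bar>h\<bar> * d \<le> 1 / 4"
  shows "(\<integral>\<^sup>+ z. ennreal (normal_density 0 (sqrt d) z) * ennreal ((exp (log_tilt g h d z))\<^sup>2) \<partial>lborel)
     \<le> ennreal (exp ((\<bar>h\<bar> + 3 * g\<^sup>2) * d))"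
proof -
  let ?G = "2 * (1 - h * d) * g / (1 - 2 * h * d)"
  have "h * d \<le> \<bar>h\<bar> * d" using d by (intro mult_right_mono) auto
  then have h2: "2 * h * d < 1" using h by auto
  have "(\<integral>\<^sup>+ z. ennreal (normal_density 0 (sqrt d) z) * ennreal ((exp (log_tilt g h d z))\<^sup>2) \<partial>lborel)
    \<le> (\<integral>\<^sup>+ z. ennreal (exp ((\<bar>h\<bar> + 3 * g\<^sup>2) * d)) *
         (ennreal (normal_density 0 (sqrt d) z) * ennreal (exp (log_tilt ?G (2 * h) d z))) \<partial>lborel)"
  proof (rule nn_integral_mono)
    fix z
    let ?n = "normal_density 0 (sqrt d) z" and ?K = "exp ((\<bar>h\<bar> + 3 * g\<^sup>2) * d)"
      and ?w = "exp (log_tilt ?G (2 * h) d z)"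
    have "?n * (exp (log_tilt g h d z))\<^sup>2 \<le> ?n * (?K * ?w)"
      using exp_log_tilt_squared[OF assms] by (rule mult_left_mono) simp
    then have "?n * (exp (log_tilt g h d z))\<^sup>2 \<le> ?K * (?n * ?w)" by (simp only: mult_ac)
    then show "ennreal ?n * ennreal ((exp (log_tilt g h d z))\<^sup>2) \<le> ennreal ?K * (ennreal ?n * ennreal ?w)"
      by (simp add: ennreal_leI flip: ennreal_mult')
  qed
  also have "\<dots> = ennreal (exp ((\<bar>h\<bar> + 3 * g\<^sup>2) * d))"
    by (subst nn_integral_cmult) (auto simp: nn_integral_tilt_density[OF d h2])
  finally show ?thesis .
qed

section \<open>The filtration, and integrating out the next increment\<close>

lemma
  assumes "standard_brownian_motion M F W"
  shows sbm_prob_space: "prob_space M"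
    and sbm_space: "space (F t) = space M"
    and sbm_sets: "sets (F t) \<subseteq> sets M"
    and sbm_mono: "s \<le> t \<Longrightarrow> sets (F s) \<subseteq> sets (F t)"
    and sbm_adapted: "0 \<le> t \<Longrightarrow> W t \<in> borel_measurable (F t)"
  using assms
  unfolding standard_brownian_motion_def filtered_prob_space_def subalgebra_def adapted_process_def
    filtration_def
  by auto

lemma sbm_measurable_mono:
  assumes "standard_brownian_motion M F W" "f \<in> measurable (F s) N" "s \<le> t"
  shows "f \<in> measurable (F t) N"
  using assms(2) sbm_mono[OF assms(1,3)] sbm_space[OF assms(1)]
  unfolding measurable_def by auto

lemma sbm_measurable_M:
  assumes "standard_brownian_motion M F W" "f \<in> measurable (F s) N"
  shows "f \<in> measurable M N"
  using assms(2) sbm_sets[OF assms(1), of s] sbm_space[OF assms(1), of s]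
  unfolding measurable_def by auto

text \<open>Independence of the increment from the past makes the joint law of the past and the
  increment a product, and Fubini's theorem integrates the Gaussian variable with the past
  frozen.\<close>

lemma nn_integral_sbm_increment:
  assumes bm: "standard_brownian_motion M F W" and st: "0 \<le> s" "s < t"
    and \<psi> [measurable]: "(\<lambda>(\<omega>, z). \<psi> \<omega> z) \<in> borel_measurable (F s \<Otimes>\<^sub>M borel)"
  shows "(\<integral>\<^sup>+ \<omega>. \<psi> \<omega> (W t \<omega> - W s \<omega>) \<partial>M) =
         (\<integral>\<^sup>+ \<omega>. (\<integral>\<^sup>+ z. ennreal (normal_density 0 (sqrt (t - s)) z) * \<psi> \<omega> z \<partial>lborel) \<partial>M)"
proof -
  interpret prob_space M by (rule sbm_prob_space[OF bm])
  let ?\<xi> = "\<lambda>\<omega>. W t \<omega> - W s \<omega>"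
  let ?n = "\<lambda>z. ennreal (normal_density 0 (sqrt (t - s)) z)"
  have dist: "distributed M lborel ?\<xi> (normal_density 0 (sqrt (t - s)))"
    and ind: "indep_set (sets (F s)) {?\<xi> -` A \<inter> space M | A. A \<in> sets borel}"
    using bm st unfolding standard_brownian_motion_def by auto
  \<comment> \<open>The identity serves as a random variable with values in the coarser space
    \<open>F s\<close>; its law is M restricted to the past.\<close>
  have id [measurable]: "(\<lambda>\<omega>. \<omega>) \<in> measurable M (F s)"
    by (rule sbm_measurable_M[OF bm, where s=s]) simp
  have [measurable]: "?\<xi> \<in> borel_measurable M"
    using distributed_measurable[OF dist] by simp
  have eq: "distr M (F s) (\<lambda>\<omega>. \<omega>) \<Otimes>\<^sub>M distr M borel ?\<xi> =
      distr M (F s \<Otimes>\<^sub>M borel) (\<lambda>\<omega>. (\<omega>, ?\<xi> \<omega>))"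
  proof (rule pair_measure_eqI)
    interpret N1: prob_space "distr M (F s) (\<lambda>\<omega>. \<omega>)" by (rule prob_space_distr) simp
    interpret N2: prob_space "distr M borel ?\<xi>" by (rule prob_space_distr) simp
    show "sigma_finite_measure (distr M (F s) (\<lambda>\<omega>. \<omega>))" "sigma_finite_measure (distr M borel ?\<xi>)"
      by unfold_locales
  next
    fix A and B :: "real set"
    assume "A \<in> sets (distr M (F s) (\<lambda>\<omega>. \<omega>))" "B \<in> sets (distr M borel ?\<xi>)"
    then have [measurable]: "A \<in> sets (F s)" "B \<in> sets borel" by auto
    have A: "A \<inter> space M = A"
      using sets.sets_into_space[OF \<open>A \<in> sets (F s)\<close>] sbm_space[OF bm, of s] by auto
    have "prob (A \<inter> (?\<xi> -` B \<inter> space M)) = prob A * prob (?\<xi> -` B \<inter> space M)"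
      by (rule indep_setD[OF ind]) auto
    moreover have "(\<lambda>\<omega>. (\<omega>, ?\<xi> \<omega>)) -` (A \<times> B) \<inter> space M = A \<inter> (?\<xi> -` B \<inter> space M)"
      using A by auto
    ultimately show "emeasure (distr M (F s) (\<lambda>\<omega>. \<omega>)) A * emeasure (distr M borel ?\<xi>) B =
        emeasure (distr M (F s \<Otimes>\<^sub>M borel) (\<lambda>\<omega>. (\<omega>, ?\<xi> \<omega>))) (A \<times> B)"
      by (simp add: emeasure_distr emeasure_eq_measure A flip: ennreal_mult')
  next
    show "sets (distr M (F s) (\<lambda>\<omega>. \<omega>) \<Otimes>\<^sub>M distr M borel ?\<xi>) =
        sets (distr M (F s \<Otimes>\<^sub>M borel) (\<lambda>\<omega>. (\<omega>, ?\<xi> \<omega>)))"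
      by (subst sets_distr, rule sets_pair_measure_cong) (rule sets_distr)+
  qed
  have d2: "distr M borel ?\<xi> = density lborel ?n"
  proof -
    have "distr M borel ?\<xi> = distr M lborel ?\<xi>" by (rule distr_cong) auto
    then show ?thesis using distributed_distr_eq_density[OF dist] by simp
  qed
  interpret N: prob_space "distr M borel ?\<xi>" by (rule prob_space_distr) simp
  have m1: "(\<lambda>\<omega>. \<integral>\<^sup>+ z. \<psi> \<omega> z \<partial>distr M borel ?\<xi>) \<in> borel_measurable (F s)"
    by (rule N.borel_measurable_nn_integral) simp
  have "(\<integral>\<^sup>+ \<omega>. \<psi> \<omega> (?\<xi> \<omega>) \<partial>M)
      = (\<integral>\<^sup>+ p. case_prod \<psi> p \<partial>distr M (F s \<Otimes>\<^sub>M borel) (\<lambda>\<omega>. (\<omega>, ?\<xi> \<omega>)))"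
    by (subst nn_integral_distr) auto
  also have "\<dots> = (\<integral>\<^sup>+ p. case_prod \<psi> p \<partial>(distr M (F s) (\<lambda>\<omega>. \<omega>) \<Otimes>\<^sub>M distr M borel ?\<xi>))"
    unfolding eq ..
  also have "\<dots> = (\<integral>\<^sup>+ \<omega>. \<integral>\<^sup>+ z. \<psi> \<omega> z \<partial>distr M borel ?\<xi> \<partial>distr M (F s) (\<lambda>\<omega>. \<omega>))"
    by (subst N.nn_integral_fst[symmetric]) auto
  also have "\<dots> = (\<integral>\<^sup>+ \<omega>. \<integral>\<^sup>+ z. \<psi> \<omega> z \<partial>distr M borel ?\<xi> \<partial>M)"
    using m1 by (subst nn_integral_distr) auto
  also have "\<dots> = (\<integral>\<^sup>+ \<omega>. (\<integral>\<^sup>+ z. ?n z * \<psi> \<omega> z \<partial>lborel) \<partial>M)"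
  proof (rule nn_integral_cong)
    fix \<omega> assume "\<omega> \<in> space M"
    then have [measurable]: "\<psi> \<omega> \<in> borel_measurable borel"
      using measurable_compose[OF _ \<psi>, of "\<lambda>z. (\<omega>, z)" borel] sbm_space[OF bm, of s] by simp
    show "(\<integral>\<^sup>+ z. \<psi> \<omega> z \<partial>distr M borel ?\<xi>) = (\<integral>\<^sup>+ z. ?n z * \<psi> \<omega> z \<partial>lborel)"
      unfolding d2 by (rule nn_integral_density) auto
  qed
  finally show ?thesis .
qed

section \<open>Tilted random walks\<close>

text \<open>Discrete counterpart of a stochastic exponential, after \<open>n\<close> grid steps of
  length \<open>d\<close>.\<close>

definition tilt_density ::
    "(real \<Rightarrow> 'a \<Rightarrow> real) \<Rightarrow> (nat \<Rightarrow> 'a \<Rightarrow> real) \<Rightarrow> (nat \<Rightarrow> 'a \<Rightarrow> real) \<Rightarrow> real \<Rightarrow> nat \<Rightarrow> 'a \<Rightarrow> real" where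
  "tilt_density W g h d n \<omega> =
     exp (\<Sum>k<n. log_tilt (g k \<omega>) (h k \<omega>) d (W (real (Suc k) * d) \<omega> - W (real k * d) \<omega>))"

text \<open>Under the law with density \<open>tilt_density\<close> an increment has conditional mean
  \<open>g k * d\<close>, so this is a martingale. The weights \<open>e\<close> will be the
  indicator that the path has not yet left a tube.\<close>

definition compensated_sum ::
    "(real \<Rightarrow> 'a \<Rightarrow> real) \<Rightarrow> (nat \<Rightarrow> 'a \<Rightarrow> real) \<Rightarrow> (nat \<Rightarrow> 'a \<Rightarrow> real) \<Rightarrow> real \<Rightarrow> nat \<Rightarrow> 'a \<Rightarrow> real" where
  "compensated_sum W g e d n \<omega> =
     (\<Sum>k<n. e k \<omega> * (W (real (Suc k) * d) \<omega> - W (real k * d) \<omega> - g k \<omega> * d))"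

lemma tilt_density_0 [simp]: "tilt_density W g h d 0 \<omega> = 1"
  and tilt_density_Suc: "tilt_density W g h d (Suc n) \<omega> = tilt_density W g h d n \<omega> *
    exp (log_tilt (g n \<omega>) (h n \<omega>) d (W (real (Suc n) * d) \<omega> - W (real n * d) \<omega>))"
  and tilt_density_pos [simp]: "tilt_density W g h d n \<omega> > 0"
  and tilt_density_nonneg [simp]: "tilt_density W g h d n \<omega> \<ge> 0"
  by (auto simp: tilt_density_def exp_add)

lemma compensated_sum_0 [simp]: "compensated_sum W g e d 0 \<omega> = 0"
  and compensated_sum_Suc: "compensated_sum W g e d (Suc n) \<omega> = compensated_sum W g e d n \<omega> +
    e n \<omega> * (W (real (Suc n) * d) \<omega> - W (real n * d) \<omega> - g n \<omega> * d)"
  by (auto simp: compensated_sum_def)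

text \<open>The coefficients of step \<open>k\<close> are known at its left endpoint, as for an Ito
  integrand. The bound on \<open>h\<close> keeps the variance d / (1 - h d) of a tilted increment at
  most 2 d.\<close>

locale tilted_walk =
  fixes M :: "'a measure" and F :: "real \<Rightarrow> 'a measure" and W :: "real \<Rightarrow> 'a \<Rightarrow> real"
    and g h e :: "nat \<Rightarrow> 'a \<Rightarrow> real" and d :: real
  assumes bm: "standard_brownian_motion M F W"
    and d_pos: "d > 0"
    and g_meas: "\<And>k. g k \<in> borel_measurable (F (real k * d))"
    and h_meas: "\<And>k. h k \<in> borel_measurable (F (real k * d))"
    and e_meas: "\<And>k. e k \<in> borel_measurable (F (real k * d))"
    and h_bound: "\<And>k \<omega>. h k \<omega> * d \<le> 1 / 2"
begin

abbreviation D where "D \<equiv> tilt_density W g h d"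
abbreviation S where "S \<equiv> compensated_sum W g e d"
abbreviation \<xi> where "\<xi> k \<omega> \<equiv> W (real (Suc k) * d) \<omega> - W (real k * d) \<omega>"

lemma h_less_1: "h k \<omega> * d < 1"
  using h_bound[of k \<omega>] by linarith

lemma W_meas: "k \<le> n \<Longrightarrow> W (real k * d) \<in> borel_measurable (F (real n * d))"
  using d_pos by (intro sbm_measurable_mono[OF bm sbm_adapted[OF bm]]) (auto intro!: mult_right_mono)

lemma D_meas: "D n \<in> borel_measurable (F (real n * d))"
  and S_meas: "S n \<in> borel_measurable (F (real n * d))"
proof -
  have W [measurable]: "\<xi> k \<in> borel_measurable (F (real n * d))" if "k < n" for k
    using that W_meas[of k n] W_meas[of "Suc k" n] by (intro borel_measurable_diff) auto
  have [measurable]: "g k \<in> borel_measurable (F (real n * d))" "h k \<in> borel_measurable (F (real n * d))"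
      "e k \<in> borel_measurable (F (real n * d))" if "k < n" for k
    using that d_pos
    by (auto intro!: sbm_measurable_mono[OF bm g_meas] sbm_measurable_mono[OF bm h_meas]
          sbm_measurable_mono[OF bm e_meas] mult_right_mono)
  show "D n \<in> borel_measurable (F (real n * d))" "S n \<in> borel_measurable (F (real n * d))"
    unfolding tilt_density_def[abs_def] compensated_sum_def[abs_def]
    by (auto intro!: borel_measurable_exp measurable_compose[OF _ borel_measurable_exp] borel_measurable_sum
          log_tilt_measurable borel_measurable_times borel_measurable_diff[OF W] W simp del: of_nat_Suc)
qed

lemmas D_meas_M = sbm_measurable_M[OF bm D_meas] and S_meas_M = sbm_measurable_M[OF bm S_meas]

text \<open>\<open>D n\<close> belongs to the past at time \<open>real n * d\<close> and passes
  through the Gaussian integral; each moment bound below thus reduces to a computation in one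
  variable.\<close>

lemma nn_integral_step:
  assumes [measurable]: "(\<lambda>(\<omega>, z). \<phi> \<omega> z) \<in> borel_measurable (F (real n * d) \<Otimes>\<^sub>M borel)"
  shows "(\<integral>\<^sup>+ \<omega>. ennreal (D n \<omega>) * \<phi> \<omega> (\<xi> n \<omega>) \<partial>M) =
     (\<integral>\<^sup>+ \<omega>. ennreal (D n \<omega>) * (\<integral>\<^sup>+ z. ennreal (normal_density 0 (sqrt d) z) * \<phi> \<omega> z \<partial>lborel) \<partial>M)"
proof -
  have [measurable]: "D n \<in> borel_measurable (F (real n * d))" by (rule D_meas)
  have eq: "real (Suc n) * d - real n * d = d" by (simp add: algebra_simps)
  have "(\<integral>\<^sup>+ \<omega>. ennreal (D n \<omega>) * \<phi> \<omega> (\<xi> n \<omega>) \<partial>M) = (\<integral>\<^sup>+ \<omega>. (\<integral>\<^sup>+ z.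
      ennreal (normal_density 0 (sqrt (real (Suc n) * d - real n * d)) z) * (ennreal (D n \<omega>) * \<phi> \<omega> z) \<partial>lborel) \<partial>M)"
    using d_pos by (intro nn_integral_sbm_increment[OF bm, of _ _ "\<lambda>\<omega> z. ennreal (D n \<omega>) * \<phi> \<omega> z"]) (auto intro!: mult_strict_right_mono)
  also have "\<dots> = (\<integral>\<^sup>+ \<omega>. ennreal (D n \<omega>) * (\<integral>\<^sup>+ z. ennreal (normal_density 0 (sqrt d) z) * \<phi> \<omega> z \<partial>lborel) \<partial>M)"
  proof (rule nn_integral_cong)
    fix \<omega> assume "\<omega> \<in> space M"
    then have [measurable]: "\<phi> \<omega> \<in> borel_measurable borel"
      using measurable_compose[OF _ assms, of "\<lambda>z. (\<omega>, z)" borel] sbm_space[OF bm, of "real n * d"] by simp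
    show "(\<integral>\<^sup>+ z. ennreal (normal_density 0 (sqrt (real (Suc n) * d - real n * d)) z) * (ennreal (D n \<omega>) * \<phi> \<omega> z) \<partial>lborel) =
       ennreal (D n \<omega>) * (\<integral>\<^sup>+ z. ennreal (normal_density 0 (sqrt d) z) * \<phi> \<omega> z \<partial>lborel)"
      unfolding eq by (subst nn_integral_cmult[symmetric]) (auto simp: mult_ac)
  qed
  finally show ?thesis .
qed

lemma nn_integral_D: "(\<integral>\<^sup>+ \<omega>. ennreal (D n \<omega>) \<partial>M) = 1"
proof (induction n)
  case 0
  then show ?case using prob_space.emeasure_space_1[OF sbm_prob_space[OF bm]] by simp
next
  case (Suc n)
  note [measurable] = g_meas h_meas
  have "(\<integral>\<^sup>+ \<omega>. ennreal (D (Suc n) \<omega>) \<partial>M) =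
      (\<integral>\<^sup>+ \<omega>. ennreal (D n \<omega>) * ennreal (exp (log_tilt (g n \<omega>) (h n \<omega>) d (\<xi> n \<omega>))) \<partial>M)"
    by (simp add: tilt_density_Suc ennreal_mult')
  also have "\<dots> = (\<integral>\<^sup>+ \<omega>. ennreal (D n \<omega>) * 1 \<partial>M)"
    using h_less_1
    by (subst nn_integral_step[where \<phi> = "\<lambda>\<omega> z. ennreal (exp (log_tilt (g n \<omega>) (h n \<omega>) d z))"])
      (auto intro!: nn_integral_cong simp: nn_integral_tilt_density[OF d_pos])
  finally show ?case using Suc by simp
qed

text \<open>Orthogonality of martingale increments under the tilted law: each step adds a squared
  weight times the tilted variance, at most 2 d.\<close>

lemma nn_integral_D_S_squared:
  assumes e: "\<And>k \<omega>. (e k \<omega>)\<^sup>2 \<le> 1"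
  shows "(\<integral>\<^sup>+ \<omega>. ennreal (D n \<omega> * (S n \<omega>)\<^sup>2) \<partial>M) \<le> ennreal (2 * d * real n)"
proof (induction n)
  case 0
  then show ?case by simp
next
  case (Suc n)
  note [measurable] = g_meas h_meas e_meas S_meas
  have "(\<integral>\<^sup>+ \<omega>. ennreal (D (Suc n) \<omega> * (S (Suc n) \<omega>)\<^sup>2) \<partial>M) =
      (\<integral>\<^sup>+ \<omega>. ennreal (D n \<omega>) * ennreal (exp (log_tilt (g n \<omega>) (h n \<omega>) d (\<xi> n \<omega>)) *
         (S n \<omega> + e n \<omega> * (\<xi> n \<omega> - g n \<omega> * d))\<^sup>2) \<partial>M)"
    by (simp add: tilt_density_Suc compensated_sum_Suc mult.assoc ennreal_mult')
  also have "\<dots> = (\<integral>\<^sup>+ \<omega>. ennreal (D n \<omega>) * ennreal ((S n \<omega>)\<^sup>2 + (e n \<omega>)\<^sup>2 * (d / (1 - h n \<omega> * d))) \<partial>M)"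
    using h_less_1
    by (subst nn_integral_step[where \<phi> = "\<lambda>\<omega> z. ennreal (exp (log_tilt (g n \<omega>) (h n \<omega>) d z) *
         (S n \<omega> + e n \<omega> * (z - g n \<omega> * d))\<^sup>2)"])
      (auto intro!: nn_integral_cong simp: nn_integral_tilt_second_moment[OF d_pos])
  also have "\<dots> \<le> (\<integral>\<^sup>+ \<omega>. ennreal (D n \<omega> * (S n \<omega>)\<^sup>2) + ennreal (2 * d) * ennreal (D n \<omega>) \<partial>M)"
  proof (rule nn_integral_mono)
    fix \<omega>
    have "(e n \<omega>)\<^sup>2 * (d / (1 - h n \<omega> * d)) \<le> 1 * (d / (1 / 2))"
      using h_bound[of n \<omega>] d_pos e[of n \<omega>]
      by (intro mult_mono divide_left_mono) auto
    then have "D n \<omega> * ((S n \<omega>)\<^sup>2 + (e n \<omega>)\<^sup>2 * (d / (1 - h n \<omega> * d))) \<le> D n \<omega> * ((S n \<omega>)\<^sup>2 + 2 * d)"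
      by (intro mult_left_mono) auto
    also have "\<dots> = D n \<omega> * (S n \<omega>)\<^sup>2 + 2 * d * D n \<omega>" by (simp add: algebra_simps)
    finally show "ennreal (D n \<omega>) * ennreal ((S n \<omega>)\<^sup>2 + (e n \<omega>)\<^sup>2 * (d / (1 - h n \<omega> * d))) \<le>
        ennreal (D n \<omega> * (S n \<omega>)\<^sup>2) + ennreal (2 * d) * ennreal (D n \<omega>)"
      using d_pos by (simp add: ennreal_leI flip: ennreal_mult' ennreal_plus)
  qed
  also have "\<dots> = (\<integral>\<^sup>+ \<omega>. ennreal (D n \<omega> * (S n \<omega>)\<^sup>2) \<partial>M) + ennreal (2 * d)"
    using D_meas_M S_meas_M
    by (subst nn_integral_add) (auto simp: nn_integral_cmult nn_integral_D)
  also have "\<dots> \<le> ennreal (2 * d * real n) + ennreal (2 * d)"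
    by (intro add_mono Suc.IH) auto
  also have "\<dots> = ennreal (2 * d * real (Suc n))"
    using d_pos by (simp add: algebra_simps flip: ennreal_plus)
  finally show ?case .
qed

text \<open>Each step multiplies the second moment by a factor exp (O(d)), so for a fixed total time
  the densities are bounded in L^2 uniformly in the mesh.\<close>

lemma nn_integral_D_squared:
  assumes g: "\<And>k \<omega>. \<bar>g k \<omega>\<bar> \<le> B" and h: "\<And>k \<omega>. \<bar>h k \<omega>\<bar> \<le> H" and H: "H * d \<le> 1 / 4"
  shows "(\<integral>\<^sup>+ \<omega>. ennreal ((D n \<omega>)\<^sup>2) \<partial>M) \<le> ennreal (exp ((H + 3 * B\<^sup>2) * (d * real n)))"
proof (induction n)
  case 0
  then show ?case using prob_space.emeasure_space_1[OF sbm_prob_space[OF bm]] by simp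
next
  case (Suc n)
  note [measurable] = g_meas h_meas D_meas
  let ?c = "exp ((H + 3 * B\<^sup>2) * d)"
  have "(\<integral>\<^sup>+ \<omega>. ennreal ((D (Suc n) \<omega>)\<^sup>2) \<partial>M) =
      (\<integral>\<^sup>+ \<omega>. ennreal (D n \<omega>) * (ennreal (D n \<omega>) * ennreal ((exp (log_tilt (g n \<omega>) (h n \<omega>) d (\<xi> n \<omega>)))\<^sup>2)) \<partial>M)"
    by (intro nn_integral_cong)
      (simp add: tilt_density_Suc power2_eq_square mult_ac del: of_nat_Suc flip: ennreal_mult')
  also have "\<dots> = (\<integral>\<^sup>+ \<omega>. ennreal (D n \<omega>) * (\<integral>\<^sup>+ z. ennreal (normal_density 0 (sqrt d) z) *
        (ennreal (D n \<omega>) * ennreal ((exp (log_tilt (g n \<omega>) (h n \<omega>) d z))\<^sup>2)) \<partial>lborel) \<partial>M)"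
    by (rule nn_integral_step[where \<phi> = "\<lambda>\<omega> z. ennreal (D n \<omega>) * ennreal ((exp (log_tilt (g n \<omega>) (h n \<omega>) d z))\<^sup>2)"]) simp
  also have "\<dots> \<le> (\<integral>\<^sup>+ \<omega>. ennreal (D n \<omega>) * (ennreal (D n \<omega>) * ennreal ?c) \<partial>M)"
  proof (intro nn_integral_mono mult_left_mono)
    fix \<omega>
    have hd: "\<bar>h n \<omega>\<bar> * d \<le> 1 / 4"
      using h[of n \<omega>] H d_pos by (meson mult_right_mono order_trans less_imp_le)
    have g2: "(g n \<omega>)\<^sup>2 \<le> B\<^sup>2" using g[of n \<omega>] by (meson abs_ge_zero order_trans power2_le_iff_abs_le)
    have "(\<integral>\<^sup>+ z. ennreal (normal_density 0 (sqrt d) z) *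
        (ennreal (D n \<omega>) * ennreal ((exp (log_tilt (g n \<omega>) (h n \<omega>) d z))\<^sup>2)) \<partial>lborel)
      = ennreal (D n \<omega>) * (\<integral>\<^sup>+ z. ennreal (normal_density 0 (sqrt d) z) *
        ennreal ((exp (log_tilt (g n \<omega>) (h n \<omega>) d z))\<^sup>2) \<partial>lborel)"
      by (subst nn_integral_cmult[symmetric]) (auto simp: mult_ac)
    also have "\<dots> \<le> ennreal (D n \<omega>) * ennreal (exp ((\<bar>h n \<omega>\<bar> + 3 * (g n \<omega>)\<^sup>2) * d))"
      by (intro mult_left_mono nn_integral_tilt_squared[OF d_pos hd]) auto
    also have "\<dots> \<le> ennreal (D n \<omega>) * ennreal ?c"
      using h[of n \<omega>] g2 d_pos
      by (intro mult_left_mono ennreal_leI) (auto intro!: mult_right_mono)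
    finally show "(\<integral>\<^sup>+ z. ennreal (normal_density 0 (sqrt d) z) *
        (ennreal (D n \<omega>) * ennreal ((exp (log_tilt (g n \<omega>) (h n \<omega>) d z))\<^sup>2)) \<partial>lborel)
        \<le> ennreal (D n \<omega>) * ennreal ?c" .
  qed auto
  also have "\<dots> = ennreal ?c * (\<integral>\<^sup>+ \<omega>. ennreal ((D n \<omega>)\<^sup>2) \<partial>M)"
    using D_meas_M
    by (subst nn_integral_cmult[symmetric])
       (auto intro!: nn_integral_cong simp: power2_eq_square mult_ac simp flip: ennreal_mult')
  also have "\<dots> \<le> ennreal ?c * ennreal (exp ((H + 3 * B\<^sup>2) * (d * real n)))"
    by (intro mult_left_mono Suc.IH) auto
  also have "\<dots> = ennreal (exp ((H + 3 * B\<^sup>2) * (d * real (Suc n))))"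
    by (simp add: algebra_simps flip: ennreal_mult' exp_add)
  finally show ?case .
qed

end

section \<open>Fine meshes\<close>

lemma mesh_points:
  assumes "T > 0" "k < N"
  shows "0 \<le> real k * (T / real N)" "real (Suc k) * (T / real N) \<le> T"
    "real (Suc k) * (T / real N) = real k * (T / real N) + T / real N" "T / real N > 0"
proof -
  have "real (Suc k) * (T / real N) \<le> real N * (T / real N)"
    using assms by (intro mult_right_mono) auto
  then show "real (Suc k) * (T / real N) \<le> T" using assms by simp
qed (use assms in \<open>auto simp: algebra_simps add_divide_distrib\<close>)

lemma mesh_oscillation:
  fixes X :: "real \<Rightarrow> real"
  assumes X: "continuous_on {0..T} X" and T: "T > 0" and "\<delta> > 0"
  shows "\<forall>\<^sub>F N in sequentially. \<forall>k<N. \<forall>s\<in>{real k * (T / real N)..real (Suc k) * (T / real N)}.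
           \<bar>X s - X (real k * (T / real N))\<bar> < \<delta>"
proof -
  have "uniformly_continuous_on {0..T} X" using X by (intro compact_uniformly_continuous) auto
  then obtain \<eta> where \<eta>: "\<eta> > 0"
    and uc: "\<And>s t. s \<in> {0..T} \<Longrightarrow> t \<in> {0..T} \<Longrightarrow> dist s t < \<eta> \<Longrightarrow> dist (X s) (X t) < \<delta>"
    unfolding uniformly_continuous_on_def using \<open>\<delta> > 0\<close> by metis
  have "(\<lambda>N. T / real N) \<longlonglongrightarrow> 0" by real_asymp
  then have "\<forall>\<^sub>F N in sequentially. T / real N < \<eta>" using \<eta> by (rule order_tendstoD)
  then show ?thesis
  proof eventually_elim
    case (elim N)
    show ?case
    proof (intro allI impI ballI)
      fix k s assume k: "k < N" and s: "s \<in> {real k * (T / real N)..real (Suc k) * (T / real N)}"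
      have "s \<in> {0..T}" "real k * (T / real N) \<in> {0..T}" "\<bar>s - real k * (T / real N)\<bar> < \<eta>"
        using s elim mesh_points[OF T k] unfolding atLeastAtMost_iff by linarith+
      then have "dist (X s) (X (real k * (T / real N))) < \<delta>"
        by (intro uc) (auto simp only: dist_real_def)
      then show "\<bar>X s - X (real k * (T / real N))\<bar> < \<delta>" by (simp add: dist_real_def)
    qed
  qed
qed

lemma mesh_integral:
  fixes u :: "real \<Rightarrow> real"
  assumes u: "continuous_on {0..T} u" and T: "T > 0" and e: "e > 0"
  shows "\<forall>\<^sub>F N in sequentially. \<forall>k<N.
     \<bar>integral {0..real (Suc k) * (T / real N)} u - integral {0..real k * (T / real N)} u
       - u (real k * (T / real N)) * (T / real N)\<bar> \<le> e * (T / real N)"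
  using mesh_oscillation[OF u T e]
proof eventually_elim
  case (elim N)
  show ?case
  proof (intro allI impI)
    fix k assume k: "k < N"
    let ?a = "real k * (T / real N)" and ?b = "real (Suc k) * (T / real N)"
    note mp = mesh_points[OF T k]
    have int: "u integrable_on {0..?b}" "u integrable_on {?a..?b}"
      using mp by (auto intro!: integrable_continuous_real continuous_on_subset[OF u])
    have "integral {0..?b} u - integral {0..?a} u - u ?a * (T / real N) = integral {?a..?b} u - u ?a * (T / real N)"
      using Henstock_Kurzweil_Integration.integral_combine[OF mp(1) _ int(1)] mp by simp
    also have "\<dots> = integral {?a..?b} (\<lambda>s. u s - u ?a)"
      using int mp by (subst integral_diff) (auto simp: mult.commute)
    finally have eq: "integral {0..?b} u - integral {0..?a} u - u ?a * (T / real N) = integral {?a..?b} (\<lambda>s. u s - u ?a)" .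
    have "norm (integral {?a..?b} (\<lambda>s. u s - u ?a)) \<le> e * (?b - ?a)"
      using mp elim k by (intro integral_bound) 
        (auto intro!: continuous_intros continuous_on_subset[OF u] simp: less_imp_le)
    then show "\<bar>integral {0..?b} u - integral {0..?a} u - u ?a * (T / real N)\<bar> \<le> e * (T / real N)"
      using mp unfolding eq by simp
  qed
qed

lemma riemann_sum_tendsto:
  fixes u :: "real \<Rightarrow> real"
  assumes u: "continuous_on {0..T} u" and T: "T > 0"
  shows "(\<lambda>N. \<Sum>k<N. u (real k * (T / real N)) * (T / real N)) \<longlonglongrightarrow> integral {0..T} u"
proof (rule tendstoI)
  fix e :: real assume e: "e > 0"
  have "e / (2 * T) > 0" using e T by simp
  from mesh_integral[OF u T this] eventually_gt_at_top[of 0]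
  show "\<forall>\<^sub>F N in sequentially. dist (\<Sum>k<N. u (real k * (T / real N)) * (T / real N)) (integral {0..T} u) < e"
  proof eventually_elim
    case (elim N)
    let ?I = "\<lambda>k. integral {0..real k * (T / real N)} u"
    have "integral {0..T} u = (\<Sum>k<N. ?I (Suc k) - ?I k)"
      using elim by (subst sum_lessThan_telescope) auto
    then have "\<bar>integral {0..T} u - (\<Sum>k<N. u (real k * (T / real N)) * (T / real N))\<bar> =
        \<bar>\<Sum>k<N. ?I (Suc k) - ?I k - u (real k * (T / real N)) * (T / real N)\<bar>"
      by (simp add: sum_subtractf)
    also have "\<dots> \<le> (\<Sum>k<N. \<bar>?I (Suc k) - ?I k - u (real k * (T / real N)) * (T / real N)\<bar>)"
      by (rule sum_abs)
    also have "\<dots> \<le> (\<Sum>k<N. e / (2 * T) * (T / real N))"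
      using elim by (intro sum_mono) auto
    also have "\<dots> < e" using elim T e by simp
    finally show ?case by (simp add: dist_real_def abs_minus_commute)
  qed
qed

section \<open>Expansions for small increments\<close>

text \<open>An error of \<open>d\<close> per step, rather than o(d), is good enough: over the whole
  grid it adds up to \<open>T\<close>, a constant factor after exponentiation.\<close>

lemma log_tilt_approx:
  assumes B: "B \<ge> 0"
  obtains \<delta> where "\<delta> > 0"
    "\<And>g h d z. \<bar>g\<bar> \<le> B \<Longrightarrow> \<bar>h\<bar> \<le> B \<Longrightarrow> \<bar>z\<bar> \<le> \<delta> \<Longrightarrow> 0 < d \<Longrightarrow> d \<le> \<delta> \<Longrightarrow>
       \<bar>log_tilt g h d z - (g * z + h * (z\<^sup>2 - d) / 2 - g\<^sup>2 * d / 2)\<bar> \<le> d"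
proof
  \<comment> \<open>The cube dominates \<open>B\<close>, its square and its cube at once, so each of
    them times \<open>\<delta>\<close> is at most 1/4.\<close>
  define \<delta> where "\<delta> = 1 / (4 * (1 + B) ^ 3)"
  show "\<delta> > 0" using B by (simp add: \<delta>_def)
  have B3: "B \<le> (1 + B) ^ 3" "B\<^sup>2 \<le> (1 + B) ^ 3" "B ^ 3 \<le> (1 + B) ^ 3"
  proof -
    have "0 \<le> B * B" "0 \<le> B * B * B" using B by auto
    then show "B \<le> (1 + B) ^ 3" "B\<^sup>2 \<le> (1 + B) ^ 3" "B ^ 3 \<le> (1 + B) ^ 3"
      using B by (auto simp: power3_eq_cube power2_eq_square algebra_simps)
  qed
  have c: "c * \<delta> \<le> 1 / 4" if "c \<le> (1 + B) ^ 3" for c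
    using that B unfolding \<delta>_def by (simp add: divide_le_eq)
  fix g h d z assume g: "\<bar>g\<bar> \<le> B" and h: "\<bar>h\<bar> \<le> B" and z: "\<bar>z\<bar> \<le> \<delta>" and d: "0 < d" "d \<le> \<delta>"
  have hd: "\<bar>h * d\<bar> \<le> B * d" using h d by (simp add: abs_mult mult_right_mono)
  also have "\<dots> \<le> B * \<delta>" using d B by (intro mult_left_mono) auto
  also have "\<dots> \<le> 1 / 4" by (intro c B3)
  finally have hd4: "\<bar>h * d\<bar> \<le> 1 / 4" .
  have "\<bar>ln (1 + - (h * d)) - - (h * d)\<bar> \<le> 2 * (- (h * d))\<^sup>2"
    using hd4 by (intro abs_ln_one_plus_x_minus_x_bound) auto
  then have "\<bar>ln (1 - h * d) + h * d\<bar> \<le> 2 * \<bar>h * d\<bar> * \<bar>h * d\<bar>" by (simp add: power2_eq_square mult.assoc flip: abs_mult)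
  also have "\<dots> \<le> 2 * (B * d) * (B * \<delta>)"
    using hd \<open>B * d \<le> B * \<delta>\<close> B d by (intro mult_mono) auto
  also have "\<dots> = 2 * d * (B\<^sup>2 * \<delta>)" by (simp add: power2_eq_square)
  also have "\<dots> \<le> 2 * d * (1 / 4)" using d by (intro mult_left_mono c B3) auto
  finally have 1: "\<bar>ln (1 - h * d) + h * d\<bar> \<le> d / 2" by simp
  have "\<bar>h * d * g * z\<bar> = \<bar>h * d\<bar> * \<bar>g\<bar> * \<bar>z\<bar>" by (simp add: abs_mult)
  also have "\<dots> \<le> (B * d) * B * \<delta>" using hd g z B d by (intro mult_mono) auto
  also have "\<dots> = d * (B\<^sup>2 * \<delta>)" by (simp add: power2_eq_square)
  also have "\<dots> \<le> d * (1 / 4)" using d by (intro mult_left_mono c B3) auto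
  finally have 2: "\<bar>h * d * g * z\<bar> \<le> d / 4" by simp
  have "\<bar>h * d * g\<^sup>2 * d\<bar> = \<bar>h * d\<bar> * (\<bar>g\<bar> * \<bar>g\<bar>) * d" using d by (simp add: abs_mult power2_eq_square)
  also have "\<dots> \<le> (B * d) * (B * B) * \<delta>" using hd g d B by (intro mult_mono) auto
  also have "\<dots> = d * (B ^ 3 * \<delta>)" by (simp add: power3_eq_cube)
  also have "\<dots> \<le> d * (1 / 4)" using d by (intro mult_left_mono c B3) auto
  finally have 3: "\<bar>h * d * g\<^sup>2 * d\<bar> \<le> d / 4" by simp
  have "log_tilt g h d z - (g * z + h * (z\<^sup>2 - d) / 2 - g\<^sup>2 * d / 2) =
      (ln (1 - h * d) + h * d) / 2 - h * d * g * z + h * d * g\<^sup>2 * d / 2"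
    by (simp add: log_tilt_def field_simps)
  moreover have "\<bar>a / 2 - b + c / 2\<bar> \<le> d" if "\<bar>a\<bar> \<le> d / 2" "\<bar>b\<bar> \<le> d / 4" "\<bar>c\<bar> \<le> d / 4" for a b c
    using that d by linarith
  ultimately show "\<bar>log_tilt g h d z - (g * z + h * (z\<^sup>2 - d) / 2 - g\<^sup>2 * d / 2)\<bar> \<le> d"
    using 1 2 3 by metis
qed

lemma uniformly_continuous_strip:
  fixes u :: "real \<Rightarrow> real \<Rightarrow> real"
  assumes u: "continuous_on ({0..T} \<times> UNIV) (\<lambda>(t, y). u t y)" and e: "e > 0"
  obtains \<delta> where "\<delta> > 0"
    "\<And>t t' y y'. t \<in> {0..T} \<Longrightarrow> t' \<in> {0..T} \<Longrightarrow> \<bar>y\<bar> \<le> R \<Longrightarrow> \<bar>y'\<bar> \<le> R \<Longrightarrow> \<bar>t' - t\<bar> \<le> \<delta> \<Longrightarrow> \<bar>y' - y\<bar> \<le> \<delta> \<Longrightarrow>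
       \<bar>u t' y' - u t y\<bar> \<le> e"
proof -
  have "uniformly_continuous_on ({0..T} \<times> {-R..R}) (\<lambda>(t, y). u t y)"
    by (intro compact_uniformly_continuous continuous_on_subset[OF u] compact_Times) auto
  then obtain \<delta> where \<delta>: "\<delta> > 0"
    and uc: "\<And>p p'. p \<in> {0..T} \<times> {-R..R} \<Longrightarrow> p' \<in> {0..T} \<times> {-R..R} \<Longrightarrow> dist p' p < \<delta> \<Longrightarrow>
       dist (case p' of (t, y) \<Rightarrow> u t y) (case p of (t, y) \<Rightarrow> u t y) < e"
    unfolding uniformly_continuous_on_def using e by metis
  show ?thesis
  proof
    show "\<delta> / 3 > 0" using \<delta> by simp
    fix t t' y y' assume *: "t \<in> {0..T}" "t' \<in> {0..T}" "\<bar>y\<bar> \<le> R" "\<bar>y'\<bar> \<le> R" "\<bar>t' - t\<bar> \<le> \<delta> / 3" "\<bar>y' - y\<bar> \<le> \<delta> / 3"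
    have "dist (t', y') (t, y) \<le> dist t' t + dist y' y"
      unfolding dist_Pair_Pair by (rule sqrt_sum_squares_le_sum) auto
    also have "\<dots> < \<delta>" using * \<delta> by (simp add: dist_real_def)
    finally show "\<bar>u t' y' - u t y\<bar> \<le> e"
      using uc[of "(t, y)" "(t', y')"] * by (auto simp: dist_real_def abs_le_iff)
  qed
qed

lemma bounded_strip:
  fixes u :: "real \<Rightarrow> real \<Rightarrow> real"
  assumes u: "continuous_on ({0..T} \<times> UNIV) (\<lambda>(t, y). u t y)"
  obtains B where "B \<ge> 0" "\<And>t y. t \<in> {0..T} \<Longrightarrow> \<bar>y\<bar> \<le> R \<Longrightarrow> \<bar>u t y\<bar> \<le> B"
proof -
  have "compact ((\<lambda>(t, y). u t y) ` ({0..T} \<times> {-R..R}))"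
    by (intro compact_continuous_image continuous_on_subset[OF u] compact_Times) auto
  then obtain B where B: "\<And>z. z \<in> (\<lambda>(t, y). u t y) ` ({0..T} \<times> {-R..R}) \<Longrightarrow> \<bar>z\<bar> \<le> B"
    using compact_imp_bounded bounded_iff by (metis real_norm_def)
  show ?thesis
  proof
    show "\<bar>B\<bar> \<ge> 0" by simp
    fix t y assume "t \<in> {0..T}" "\<bar>y\<bar> \<le> R"
    then have "u t y \<in> (\<lambda>(t, y). u t y) ` ({0..T} \<times> {-R..R})"
      by (intro image_eqI[of _ _ "(t, y)"]) auto
    then show "\<bar>u t y\<bar> \<le> \<bar>B\<bar>" using B by fastforce
  qed
qed

text \<open>The intermediate point is located twice: its distance to \<open>y\<close> serves uniform
  continuity, its place on the segment keeps it in a bounded region.\<close>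

lemma taylor2_real:
  fixes f f1 f2 :: "real \<Rightarrow> real"
  assumes f: "\<And>y. (f has_real_derivative f1 y) (at y)"
    and f1: "\<And>y. (f1 has_real_derivative f2 y) (at y)"
  obtains c where "\<bar>c - y\<bar> \<le> \<bar>y' - y\<bar>" "c \<in> closed_segment y y'"
    "f y' = f y + f1 y * (y' - y) + f2 c * (y' - y)\<^sup>2 / 2"
proof (cases "y' = y")
  case True
  then show ?thesis using that[of y] by simp
next
  case False
  define D where "D m = (case m of 0 \<Rightarrow> f | Suc 0 \<Rightarrow> f1 | _ \<Rightarrow> f2)" for m :: nat
  have "\<exists>t. (if y' < y then y' < t \<and> t < y else y < t \<and> t < y') \<and>
      f y' = (\<Sum>m<2. (D m y / fact m) * (y' - y) ^ m) + (D 2 t / fact 2) * (y' - y) ^ 2"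
  proof (rule Taylor[where a = "min y y'" and b = "max y y'"])
    show "\<forall>m t. m < 2 \<and> min y y' \<le> t \<and> t \<le> max y y' \<longrightarrow> (D m has_real_derivative D (Suc m) t) (at t)"
      using f f1 by (auto simp: D_def less_2_cases_iff)
  qed (use False in \<open>auto simp: D_def\<close>)
  then obtain t where t: "if y' < y then y' < t \<and> t < y else y < t \<and> t < y'"
    and eq: "f y' = (\<Sum>m<2. (D m y / fact m) * (y' - y) ^ m) + (D 2 t / fact 2) * (y' - y) ^ 2" by blast
  show ?thesis
  proof (rule that[of t])
    show "f y' = f y + f1 y * (y' - y) + f2 t * (y' - y)\<^sup>2 / 2"
      using eq by (simp add: D_def numeral_2_eq_2)
  qed (use t in \<open>auto simp: closed_segment_eq_real_ivl split: if_splits\<close>)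
qed

section \<open>A discrete Ito formula along a path\<close>

text \<open>The regularity of the Ito formula, C^1 in time and C^2 in space; the time derivative is
  one-sided at both ends of the interval.\<close>

locale space_time_function =
  fixes f ft fy fyy :: "real \<Rightarrow> real \<Rightarrow> real" and T :: real
  assumes T_pos: "T > 0"
    and ft: "\<And>t y. t \<in> {0..T} \<Longrightarrow> ((\<lambda>t. f t y) has_real_derivative ft t y) (at t within {0..T})"
    and fy: "\<And>t y. t \<in> {0..T} \<Longrightarrow> (f t has_real_derivative fy t y) (at y)"
    and fyy: "\<And>t y. t \<in> {0..T} \<Longrightarrow> (fy t has_real_derivative fyy t y) (at y)"
    and ft_cont: "continuous_on ({0..T} \<times> UNIV) (\<lambda>(t, y). ft t y)"
    and fy_cont: "continuous_on ({0..T} \<times> UNIV) (\<lambda>(t, y). fy t y)"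
    and fyy_cont: "continuous_on ({0..T} \<times> UNIV) (\<lambda>(t, y). fyy t y)"
begin

text \<open>The increment splits into a move in time at the new position and a move in space at the
  old time. The mean value theorem and Lagrange's remainder give coefficients at nearby points, and
  uniform continuity moves them to (t, y).\<close>

lemma taylor_increment:
  assumes "e > 0"
  obtains \<delta> where "\<delta> > 0"
    "\<And>t t' y y'. t \<in> {0..T} \<Longrightarrow> t' \<in> {0..T} \<Longrightarrow> t < t' \<Longrightarrow> \<bar>y\<bar> \<le> R \<Longrightarrow> \<bar>y'\<bar> \<le> R \<Longrightarrow> t' - t \<le> \<delta> \<Longrightarrow> \<bar>y' - y\<bar> \<le> \<delta> \<Longrightarrow>
       \<bar>f t' y' - f t y - (ft t y * (t' - t) + fy t y * (y' - y) + fyy t y * (y' - y)\<^sup>2 / 2)\<bar>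
         \<le> e * (t' - t) + e * (y' - y)\<^sup>2 / 2"
proof -
  obtain \<delta>1 where \<delta>1: "\<delta>1 > 0" "\<And>t t' y y'. t \<in> {0..T} \<Longrightarrow> t' \<in> {0..T} \<Longrightarrow> \<bar>y\<bar> \<le> R \<Longrightarrow> \<bar>y'\<bar> \<le> R \<Longrightarrow>
      \<bar>t' - t\<bar> \<le> \<delta>1 \<Longrightarrow> \<bar>y' - y\<bar> \<le> \<delta>1 \<Longrightarrow> \<bar>ft t' y' - ft t y\<bar> \<le> e"
    using uniformly_continuous_strip[OF ft_cont assms] by metis
  obtain \<delta>2 where \<delta>2: "\<delta>2 > 0" "\<And>t t' y y'. t \<in> {0..T} \<Longrightarrow> t' \<in> {0..T} \<Longrightarrow> \<bar>y\<bar> \<le> R \<Longrightarrow> \<bar>y'\<bar> \<le> R \<Longrightarrow>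
      \<bar>t' - t\<bar> \<le> \<delta>2 \<Longrightarrow> \<bar>y' - y\<bar> \<le> \<delta>2 \<Longrightarrow> \<bar>fyy t' y' - fyy t y\<bar> \<le> e"
    using uniformly_continuous_strip[OF fyy_cont assms] by metis
  show ?thesis
  proof (rule that[of "min \<delta>1 \<delta>2"])
    show "min \<delta>1 \<delta>2 > 0" using \<delta>1 \<delta>2 by simp
    fix t t' y y'
    assume *: "t \<in> {0..T}" "t' \<in> {0..T}" "t < t'" "\<bar>y\<bar> \<le> R" "\<bar>y'\<bar> \<le> R"
      "t' - t \<le> min \<delta>1 \<delta>2" "\<bar>y' - y\<bar> \<le> min \<delta>1 \<delta>2"
    have "\<exists>z\<in>{t<..<t'}. f t' y' - f t y' = (\<lambda>h. h * ft z y') (t' - t)"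
      using *(1-3)
      by (intro mvt_simple[of t t' "\<lambda>t. f t y'" "\<lambda>z h. h * ft z y'"])
         (auto simp: mult.commute[of _ "ft _ _"] simp flip: has_field_derivative_def intro: DERIV_subset[OF ft])
    then obtain \<tau> where \<tau>: "t < \<tau>" "\<tau> < t'" "f t' y' - f t y' = (t' - t) * ft \<tau> y'" by auto
    obtain c where c: "\<bar>c - y\<bar> \<le> \<bar>y' - y\<bar>" "c \<in> closed_segment y y'"
      "f t y' = f t y + fy t y * (y' - y) + fyy t c * (y' - y)\<^sup>2 / 2"
      using taylor2_real[OF fy[OF *(1)] fyy[OF *(1)]] by metis
    have "\<bar>ft \<tau> y' - ft t y\<bar> \<le> e" using * \<tau> by (intro \<delta>1) auto
    then have 1: "\<bar>(ft \<tau> y' - ft t y) * (t' - t)\<bar> \<le> e * (t' - t)"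
      using * by (simp add: abs_mult mult_right_mono)
    have "\<bar>c\<bar> \<le> R" using c(2) *(4,5) by (auto simp: closed_segment_eq_real_ivl split: if_splits)
    then have "\<bar>fyy t c - fyy t y\<bar> \<le> e" using * c(1) \<delta>2(1) by (intro \<delta>2) auto
    then have 2: "\<bar>(fyy t c - fyy t y) * (y' - y)\<^sup>2\<bar> \<le> e * (y' - y)\<^sup>2"
      by (simp add: abs_mult mult_right_mono)
    have "f t' y' - f t y - (ft t y * (t' - t) + fy t y * (y' - y) + fyy t y * (y' - y)\<^sup>2 / 2)
       = (ft \<tau> y' - ft t y) * (t' - t) + (fyy t c - fyy t y) * (y' - y)\<^sup>2 / 2"
      using \<tau>(3) c(3) by (simp add: field_simps)
    then show "\<bar>f t' y' - f t y - (ft t y * (t' - t) + fy t y * (y' - y) + fyy t y * (y' - y)\<^sup>2 / 2)\<bar>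
         \<le> e * (t' - t) + e * (y' - y)\<^sup>2 / 2"
      using 1 2 by linarith
  qed
qed

end

text \<open>A single trajectory of the equation, with no probability left; additive noise lets the
  equation be read path by path.\<close>

locale driven_path = space_time_function f ft fy fyy T
  for f ft fy fyy :: "real \<Rightarrow> real \<Rightarrow> real" and T :: real +
  fixes lam X W :: "real \<Rightarrow> real" and x \<sigma> :: real
  assumes \<sigma>_pos: "\<sigma> > 0"
    and lam_cont: "continuous_on UNIV lam"
    and X_cont: "continuous_on {0..T} X"
    and W_cont: "continuous_on {0..T} W"
    and X_eq: "\<And>t. t \<in> {0..T} \<Longrightarrow> X t = x + integral {0..t} (\<lambda>s. lam (X s)) + \<sigma> * W t"
begin

lemma lam_X_cont: "continuous_on {0..T} (\<lambda>s. lam (X s))"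
  by (rule continuous_on_compose2[OF lam_cont X_cont]) auto

lemma X_bounded: obtains R where "R \<ge> 0" "\<And>t. t \<in> {0..T} \<Longrightarrow> \<bar>X t\<bar> \<le> R"
proof -
  have "continuous_on ({0..T} \<times> (UNIV :: real set)) (\<lambda>(t, y). X t)"
    by (auto simp: case_prod_unfold intro!: continuous_on_compose2[OF X_cont] continuous_intros)
  from bounded_strip[OF this, of 0] show ?thesis using that by (metis abs_zero order_refl)
qed

text \<open>Formally, the increment of \<open>f t (X t)\<close> minus the time integral of
  \<open>GG\<close> is the logarithm of the stochastic exponential with integrand
  \<open>gg\<close>.\<close>

abbreviation "gg t \<equiv> \<sigma> * fy t (X t)"
abbreviation "hh t \<equiv> \<sigma>\<^sup>2 * fyy t (X t)"
abbreviation "GG t \<equiv> ft t (X t) + lam (X t) * fy t (X t) + hh t / 2 + (gg t)\<^sup>2 / 2"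

text \<open>The summand \<open>1\<close> subtracted from or added to \<^term>\<open>hh t\<close> absorbs the part of the Taylor error
  that is proportional to the squared increment of \<^term>\<open>W\<close>; hence no estimate of the quadratic
  variation is needed.\<close>

lemma log_tilt_increment:
  "\<forall>\<^sub>F N in sequentially. \<forall>k<N.
    (let d = T / real N; t = real k * d; t' = real (Suc k) * d; \<xi> = W t' - W t in
       log_tilt (gg t) (hh t - 1) d \<xi> + (GG t - 3) * d \<le> f t' (X t') - f t (X t) \<and>
       f t' (X t') - f t (X t) \<le> log_tilt (gg t) (hh t + 1) d \<xi> + (GG t + 3) * d)"
proof -
  obtain R where R: "R \<ge> 0" "\<And>t. t \<in> {0..T} \<Longrightarrow> \<bar>X t\<bar> \<le> R" using X_bounded by blast
  have "continuous_on ({0..T} \<times> UNIV) (\<lambda>(t::real, y). lam y)"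
    by (auto simp: case_prod_unfold intro!: continuous_on_compose2[OF lam_cont] continuous_intros)
  then obtain L where L: "L \<ge> 0" "\<And>t y. t \<in> {0..T} \<Longrightarrow> \<bar>y\<bar> \<le> R \<Longrightarrow> \<bar>lam y\<bar> \<le> L"
    using bounded_strip by metis
  obtain B1 where B1: "B1 \<ge> 0" "\<And>t y. t \<in> {0..T} \<Longrightarrow> \<bar>y\<bar> \<le> R \<Longrightarrow> \<bar>fy t y\<bar> \<le> B1"
    using bounded_strip[OF fy_cont] by metis
  obtain B2 where B2: "B2 \<ge> 0" "\<And>t y. t \<in> {0..T} \<Longrightarrow> \<bar>y\<bar> \<le> R \<Longrightarrow> \<bar>fyy t y\<bar> \<le> B2"
    using bounded_strip[OF fyy_cont] by metis
  define B where "B = \<sigma> * B1 + \<sigma>\<^sup>2 * B2 + 1"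
  have B: "B \<ge> 0" using B1 B2 \<sigma>_pos by (simp add: B_def)
  obtain \<delta>1 where \<delta>1: "\<delta>1 > 0" "\<And>g h d z. \<bar>g\<bar> \<le> B \<Longrightarrow> \<bar>h\<bar> \<le> B \<Longrightarrow> \<bar>z\<bar> \<le> \<delta>1 \<Longrightarrow> 0 < d \<Longrightarrow> d \<le> \<delta>1 \<Longrightarrow>
       \<bar>log_tilt g h d z - (g * z + h * (z\<^sup>2 - d) / 2 - g\<^sup>2 * d / 2)\<bar> \<le> d"
    using log_tilt_approx[OF B] by metis
  \<comment> \<open>With \<open>1 / \<sigma>\<^sup>2\<close> the noise part of the quadratic Taylor
    error is at most half the squared increment of \<open>W\<close>, just what a shift of
    \<open>hh t\<close> by 1 compensates.\<close>
  define e where "e = min (1 / 4) (1 / \<sigma>\<^sup>2)"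
  have e: "e > 0" "e \<le> 1 / 4" "e * \<sigma>\<^sup>2 \<le> 1"
    using \<sigma>_pos by (auto simp: e_def min_def field_simps)
  obtain \<delta>2 where \<delta>2: "\<delta>2 > 0" "\<And>t t' y y'. t \<in> {0..T} \<Longrightarrow> t' \<in> {0..T} \<Longrightarrow> t < t' \<Longrightarrow> \<bar>y\<bar> \<le> R \<Longrightarrow> \<bar>y'\<bar> \<le> R \<Longrightarrow>
      t' - t \<le> \<delta>2 \<Longrightarrow> \<bar>y' - y\<bar> \<le> \<delta>2 \<Longrightarrow>
       \<bar>f t' y' - f t y - (ft t y * (t' - t) + fy t y * (y' - y) + fyy t y * (y' - y)\<^sup>2 / 2)\<bar>
         \<le> e * (t' - t) + e * (y' - y)\<^sup>2 / 2"
    using taylor_increment[OF e(1)] by metis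
  \<comment> \<open>\<open>c\<close> bounds the error of the drift integral relative to the step;
    multiplied by the bounds on \<open>fy\<close> and \<open>fyy\<close> it stays at most
    1/4.\<close>
  define c where "c = min (1 / 4) (min (1 / (4 * (1 + B1))) (1 / (4 * (1 + B2))))"
  have c: "c > 0" "B1 * c \<le> 1 / 4" "B2 * c \<le> 1 / 4" "c \<le> 1 / 4"
  proof -
    have "B * c \<le> 1 / 4" if "B \<ge> 0" "c \<le> 1 / (4 * (1 + B))" for B
    proof -
      have "B * c \<le> B * (1 / (4 * (1 + B)))" using that by (intro mult_left_mono) auto
      also have "\<dots> \<le> 1 / 4" using that by (simp add: field_simps)
      finally show ?thesis .
    qed
    then show "B1 * c \<le> 1 / 4" "B2 * c \<le> 1 / 4" using B1(1) B2(1) by (auto simp: c_def)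
  qed (use B1(1) B2(1) in \<open>auto simp: c_def\<close>)
  \<comment> \<open>The last entry makes the drift contribution to the squared increment of
    \<open>X\<close> at most \<open>c\<close> times the step.\<close>
  define \<delta> where "\<delta> = min (min \<delta>1 \<delta>2) (c / (4 * (1 + L)\<^sup>2))"
  have \<delta>: "\<delta> > 0" "\<delta> \<le> \<delta>1" "\<delta> \<le> \<delta>2" "4 * (1 + L)\<^sup>2 * \<delta> \<le> c"
  proof -
    have "4 * (1 + L)\<^sup>2 * \<delta> \<le> 4 * (1 + L)\<^sup>2 * (c / (4 * (1 + L)\<^sup>2))"
      by (intro mult_left_mono) (auto simp: \<delta>_def)
    also have "\<dots> = c" using L(1) by simp
    finally show "4 * (1 + L)\<^sup>2 * \<delta> \<le> c" .
    have "(1 + L)\<^sup>2 > 0" using L(1) by simp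
    then show "\<delta> > 0" "\<delta> \<le> \<delta>1" "\<delta> \<le> \<delta>2" using \<delta>1(1) \<delta>2(1) c(1) by (auto simp: \<delta>_def)
  qed
  have "(\<lambda>N. T / real N) \<longlonglongrightarrow> 0" by real_asymp
  then have small: "\<forall>\<^sub>F N in sequentially. T / real N < \<delta>" using \<delta>(1) by (rule order_tendstoD)
  from small mesh_oscillation[OF X_cont T_pos \<delta>(1)] mesh_oscillation[OF W_cont T_pos \<delta>(1)]
    mesh_integral[OF lam_X_cont T_pos c(1)]
  show ?thesis
  proof eventually_elim
    case (elim N)
    show ?case
    proof (intro allI impI)
      fix k assume k: "k < N"
      define d t t' where "d = T / real N" and "t = real k * d" and "t' = real (Suc k) * d"
      have tT: "t \<in> {0..T}" "t' \<in> {0..T}" "t < t'" and d: "t' - t = d" "d > 0"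
        unfolding t_def t'_def d_def atLeastAtMost_iff using mesh_points[OF T_pos k] by linarith+
      define \<xi> where "\<xi> = W t' - W t"
      define y y' where "y = X t" and "y' = X t'"
      define I where "I = integral {0..t'} (\<lambda>s. lam (X s)) - integral {0..t} (\<lambda>s. lam (X s))"
      have d\<delta>: "d < \<delta>" using elim by (simp add: d_def)
      have dy: "\<bar>y' - y\<bar> < \<delta>" "\<bar>\<xi>\<bar> < \<delta>"
        using elim k tT by (auto simp: y_def y'_def \<xi>_def t_def t'_def d_def)
      have I: "\<bar>I - lam y * d\<bar> \<le> c * d"
        using elim k by (auto simp: I_def y_def t_def t'_def d_def)
      have dX: "y' - y = I + \<sigma> * \<xi>"
        using X_eq tT by (simp add: y_def y'_def I_def \<xi>_def algebra_simps)
      have yR: "\<bar>y\<bar> \<le> R" "\<bar>y'\<bar> \<le> R" using R tT by (auto simp: y_def y'_def)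
      have lamy: "\<bar>lam y\<bar> \<le> L" and fyb: "\<bar>fy t y\<bar> \<le> B1" and fyyb: "\<bar>fyy t y\<bar> \<le> B2"
        by (rule L(2) B1(2) B2(2); rule tT yR)+
      have Ib: "\<bar>I\<bar> \<le> (1 + L) * d"
      proof -
        have "\<bar>lam y * d\<bar> \<le> L * d" using lamy d by (simp add: abs_mult mult_right_mono)
        moreover have "c * d \<le> 1 * d" using c d by (intro mult_right_mono) auto
        ultimately show ?thesis using I by (simp add: algebra_simps)
      qed
      \<comment> \<open>The squared increment of \<open>X\<close> minus its pure noise part. It
        contains the drift increment \<open>I\<close>, of order \<open>d\<close>, as a factor, and
        the other factor is small.\<close>
      define q where "q = (y' - y)\<^sup>2 - \<sigma>\<^sup>2 * \<xi>\<^sup>2"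
      have "q = I * (2 * (y' - y) - I)"
      proof -
        have "\<sigma> * \<xi> = (y' - y) - I" using dX by simp
        then have "\<sigma>\<^sup>2 * \<xi>\<^sup>2 = ((y' - y) - I)\<^sup>2" by (simp flip: power_mult_distrib)
        then show ?thesis by (simp add: q_def power2_eq_square algebra_simps)
      qed
      then have "\<bar>q\<bar> = \<bar>I\<bar> * \<bar>2 * (y' - y) - I\<bar>" by (simp add: abs_mult)
      also have "\<dots> \<le> ((1 + L) * d) * (4 * (1 + L) * \<delta>)"
      proof (intro mult_mono Ib)
        have "(1 + L) * d \<le> (1 + L) * \<delta>" using d\<delta> L by (intro mult_left_mono) auto
        moreover have "1 * \<delta> \<le> (1 + L) * \<delta>" using L \<delta> by (intro mult_right_mono) auto
        ultimately have "\<bar>2 * (y' - y) - I\<bar> \<le> 2 * ((1 + L) * \<delta>) + (1 + L) * \<delta>"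
          using dy(1) Ib by (simp only: mult_1) (smt (verit))
        also have "\<dots> \<le> 4 * (1 + L) * \<delta>" using L(1) \<delta>(1) by (simp add: algebra_simps)
        finally show "\<bar>2 * (y' - y) - I\<bar> \<le> 4 * (1 + L) * \<delta>" .
      qed (use L d in auto)
      also have "\<dots> = d * (4 * (1 + L)\<^sup>2 * \<delta>)" by (simp add: power2_eq_square)
      also have "\<dots> \<le> d * c" using \<delta> d by (intro mult_left_mono) auto
      finally have q: "\<bar>q\<bar> \<le> c * d" by (simp add: mult.commute)
      have tay: "\<bar>f t' y' - f t y - (ft t y * d + fy t y * (y' - y) + fyy t y * (y' - y)\<^sup>2 / 2)\<bar>
         \<le> e * d + e * (y' - y)\<^sup>2 / 2"
        using \<delta>2(2)[OF tT yR] d d\<delta> dy \<delta> by auto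
      have E0: "e * d \<le> d / 4" using e d by (simp add: mult_right_mono field_simps)
      have E1: "e * (y' - y)\<^sup>2 \<le> \<xi>\<^sup>2 + d / 4"
      proof -
        have "e * (y' - y)\<^sup>2 = (e * \<sigma>\<^sup>2) * \<xi>\<^sup>2 + e * q" by (simp add: q_def algebra_simps)
        moreover have "(e * \<sigma>\<^sup>2) * \<xi>\<^sup>2 \<le> 1 * \<xi>\<^sup>2" using e by (intro mult_right_mono) auto
        moreover have "e * q \<le> (1 / 4) * (1 * d)"
        proof -
          have "e * q \<le> e * \<bar>q\<bar>" using e by (intro mult_left_mono) auto
          also have "\<dots> \<le> (1 / 4) * (1 * d)"
            using e q c d by (intro mult_mono order_trans[OF q] mult_right_mono) auto
          finally show ?thesis .
        qed
        ultimately show ?thesis by linarith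
      qed
      have E2: "\<bar>fy t y * (I - lam y * d)\<bar> \<le> d / 4"
      proof -
        have "\<bar>fy t y * (I - lam y * d)\<bar> \<le> B1 * (c * d)"
          unfolding abs_mult using fyb I B1 by (intro mult_mono) auto
        also have "\<dots> \<le> (1 / 4) * d" unfolding mult.assoc[symmetric] using c d by (intro mult_right_mono) auto
        finally show ?thesis by simp
      qed
      have E3: "\<bar>fyy t y * q\<bar> \<le> d / 4"
      proof -
        have "\<bar>fyy t y * q\<bar> \<le> B2 * (c * d)"
          unfolding abs_mult using fyyb q B2 by (intro mult_mono) auto
        also have "\<dots> \<le> (1 / 4) * d" unfolding mult.assoc[symmetric] using c d by (intro mult_right_mono) auto
        finally show ?thesis by simp
      qed
      have "fy t y * (y' - y) = gg t * \<xi> + lam y * fy t y * d + fy t y * (I - lam y * d)"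
        unfolding dX by (simp add: y_def algebra_simps)
      moreover have "fyy t y * (y' - y)\<^sup>2 = hh t * \<xi>\<^sup>2 + fyy t y * q"
        by (simp add: y_def q_def algebra_simps)
      ultimately have main: "\<bar>f t' y' - f t y - (ft t y * d + lam y * fy t y * d + gg t * \<xi> + hh t * \<xi>\<^sup>2 / 2)\<bar>
          \<le> d + \<xi>\<^sup>2 / 2"
        using tay E0 E1 E2 E3 by linarith
      have gb: "\<bar>gg t\<bar> \<le> \<sigma> * B1" and hb: "\<bar>hh t\<bar> \<le> \<sigma>\<^sup>2 * B2"
        using fyb fyyb \<sigma>_pos by (auto simp: abs_mult y_def mult_left_mono)
      have "\<sigma> * B1 \<ge> 0" "\<sigma>\<^sup>2 * B2 \<ge> 0" using B1 B2 \<sigma>_pos by auto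
      then have gB: "\<bar>gg t\<bar> \<le> B" and hB: "\<bar>hh t - 1\<bar> \<le> B" "\<bar>hh t + 1\<bar> \<le> B"
        using gb hb unfolding B_def by linarith+
      have z: "\<bar>\<xi>\<bar> \<le> \<delta>1" "d \<le> \<delta>1" using dy d\<delta> \<delta> by auto
      note lo = \<delta>1(2)[OF gB hB(1) z(1) d(2) z(2)] and up = \<delta>1(2)[OF gB hB(2) z(1) d(2) z(2)]
      \<comment> \<open>The budget behind the constant 3: one \<open>d\<close> from the Taylor
        expansion, one from the expansion of the tilt, half a \<open>d\<close> from shifting
        \<open>hh t\<close> by 1. With the products abstracted into variables the rest is linear
        arithmetic.\<close>
      have arith: "l + (G - 3 * d) \<le> \<Delta> \<and> \<Delta> \<le> u + (G + 3 * d)"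
        if "\<bar>\<Delta> - (a + b + p + q / 2)\<bar> \<le> d + z / 2"
          "\<bar>l - (p + (q / 2 - q' / 2 - z / 2 + d / 2) - s / 2)\<bar> \<le> d"
          "\<bar>u - (p + (q / 2 - q' / 2 + z / 2 - d / 2) - s / 2)\<bar> \<le> d"
          "G = a + b + q' / 2 + s / 2" for l u G \<Delta> a b p q q' s z :: real
        using that d(2) by linarith
      have lo_eq: "(hh t - 1) * (\<xi>\<^sup>2 - d) / 2 = hh t * \<xi>\<^sup>2 / 2 - hh t * d / 2 - \<xi>\<^sup>2 / 2 + d / 2"
        and up_eq: "(hh t + 1) * (\<xi>\<^sup>2 - d) / 2 = hh t * \<xi>\<^sup>2 / 2 - hh t * d / 2 + \<xi>\<^sup>2 / 2 - d / 2"
        by (simp_all add: field_simps)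
      have G_eq: "GG t * d = ft t y * d + lam y * fy t y * d + hh t * d / 2 + (gg t)\<^sup>2 * d / 2"
        by (simp add: y_def algebra_simps)
      have "log_tilt (gg t) (hh t - 1) d \<xi> + (GG t - 3) * d \<le> f t' y' - f t y \<and>
          f t' y' - f t y \<le> log_tilt (gg t) (hh t + 1) d \<xi> + (GG t + 3) * d"
        using arith[OF main lo[unfolded lo_eq] up[unfolded up_eq] G_eq]
        by (simp only: left_diff_distrib distrib_right)
      then show "let d = T / real N; t = real k * d; t' = real (Suc k) * d; \<xi> = W t' - W t in
         log_tilt (gg t) (hh t - 1) d \<xi> + (GG t - 3) * d \<le> f t' (X t') - f t (X t) \<and>
         f t' (X t') - f t (X t) \<le> log_tilt (gg t) (hh t + 1) d \<xi> + (GG t + 3) * d"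
        unfolding Let_def y_def y'_def \<xi>_def t_def t'_def d_def .
    qed
  qed
qed

end

section \<open>Finiteness from a supersolution\<close>

locale sde_functional = space_time_function f ft fy fyy T
  for f ft fy fyy :: "real \<Rightarrow> real \<Rightarrow> real" and T :: real +
  fixes M :: "'a measure" and F :: "real \<Rightarrow> 'a measure" and W X :: "real \<Rightarrow> 'a \<Rightarrow> real"
    and lam :: "real \<Rightarrow> real" and \<sigma> x :: real
  assumes \<sigma>_pos: "\<sigma> > 0"
    and lam_cont: "continuous_on UNIV lam"
    and sde: "sde_solution M F W lam \<sigma> x X"
begin

lemma bm: "standard_brownian_motion M F W"
  using sde by (simp add: sde_solution_def)

lemma X_meas: "0 \<le> s \<Longrightarrow> s \<le> t \<Longrightarrow> X s \<in> borel_measurable (F t)"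
  using sde by (auto simp: sde_solution_def adapted_process_def intro: sbm_measurable_mono[OF bm])

lemma fy_meas: "t \<in> {0..T} \<Longrightarrow> fy t \<in> borel_measurable borel"
  and fyy_meas: "t \<in> {0..T} \<Longrightarrow> fyy t \<in> borel_measurable borel"
  by (auto intro!: borel_measurable_continuous_onI continuous_on_compose2[OF fy_cont, where f = "\<lambda>y. (t, y)", simplified]
      continuous_on_compose2[OF fyy_cont, where f = "\<lambda>y. (t, y)", simplified] continuous_intros)

lemma AE_driven_path:
  "AE \<omega> in M. driven_path f ft fy fyy T lam (\<lambda>t. X t \<omega>) (\<lambda>t. W t \<omega>) x \<sigma> \<and> X 0 \<omega> = x"
proof -
  have "AE \<omega> in M. continuous_on {0..} (\<lambda>t. W t \<omega>)" "AE \<omega> in M. continuous_on {0..} (\<lambda>t. X t \<omega>)"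
    "AE \<omega> in M. X 0 \<omega> = x"
    "AE \<omega> in M. \<forall>t\<ge>0. X t \<omega> = x + integral {0..t} (\<lambda>s. lam (X s \<omega>)) + \<sigma> * W t \<omega>"
    using sde bm by (auto simp: sde_solution_def standard_brownian_motion_def continuous_paths_def)
  then show ?thesis
  proof eventually_elim
    case (elim \<omega>)
    show ?case
    proof (intro conjI elim(3), unfold_locales)
      show "continuous_on {0..T} (\<lambda>t. X t \<omega>)" "continuous_on {0..T} (\<lambda>t. W t \<omega>)"
        using elim by (auto elim: continuous_on_subset)
      show "X t \<omega> = x + integral {0..t} (\<lambda>s. lam (X s \<omega>)) + \<sigma> * W t \<omega>" if "t \<in> {0..T}" for t
        using elim(4) that by auto
    qed (use \<sigma>_pos lam_cont in auto)
  qed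
qed

section \<open>The energy on the grid and two-sided bounds for the exponent\<close>

definition energy_sum :: "nat \<Rightarrow> 'a \<Rightarrow> real" where
  "energy_sum N \<omega> = (\<Sum>k<N. (lam (X (real k * (T / real N)) \<omega>))\<^sup>2 / \<sigma>\<^sup>2 * (T / real N))"

lemma AE_energy_sum:
  "AE \<omega> in M. (\<lambda>N. energy_sum N \<omega>) \<longlonglongrightarrow> integral {0..T} (\<lambda>s. (lam (X s \<omega>))\<^sup>2 / \<sigma>\<^sup>2)"
  using AE_driven_path
proof eventually_elim
  case (elim \<omega>)
  then interpret driven_path f ft fy fyy T lam "\<lambda>t. X t \<omega>" "\<lambda>t. W t \<omega>" x \<sigma> by simp
  show ?case unfolding energy_sum_def
    using \<sigma>_pos by (intro riemann_sum_tendsto[OF _ T_pos] continuous_intros lam_X_cont) auto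
qed

text \<open>The rate \<open>GG\<close> of the pathwise Ito formula plus half the energy density,
  that is, the growth rate of the full exponent in excess of the logarithm of the exponential
  martingale.\<close>

definition generator_term :: "real \<Rightarrow> real \<Rightarrow> real" where
  "generator_term t y = ft t y + lam y * fy t y + \<sigma>\<^sup>2 * fyy t y / 2 + (\<sigma> * fy t y)\<^sup>2 / 2 + (lam y)\<^sup>2 / (2 * \<sigma>\<^sup>2)"

text \<open>Adding the same energy term to all members of the pathwise estimate turns
  \<open>GG\<close> into \<open>generator_term\<close>. The upper inequality serves finiteness, the
  lower one divergence; how fine the mesh must be depends on the path.\<close>

lemma AE_increments:
  "AE \<omega> in M. \<forall>\<^sub>F N in sequentially. \<forall>k<N.
    (let d = T / real N; t = real k * d; t' = real (Suc k) * d; \<xi> = W t' \<omega> - W t \<omega>; y = X t \<omega>;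
         E = (lam y)\<^sup>2 / \<sigma>\<^sup>2 * d / 2 in
       log_tilt (\<sigma> * fy t y) (\<sigma>\<^sup>2 * fyy t y - 1) d \<xi> + (generator_term t y - 3) * d
         \<le> f t' (X t' \<omega>) - f t y + E \<and>
       f t' (X t' \<omega>) - f t y + E
         \<le> log_tilt (\<sigma> * fy t y) (\<sigma>\<^sup>2 * fyy t y + 1) d \<xi> + (generator_term t y + 3) * d)"
  using AE_driven_path
proof eventually_elim
  case (elim \<omega>)
  then interpret driven_path f ft fy fyy T lam "\<lambda>t. X t \<omega>" "\<lambda>t. W t \<omega>" x \<sigma> by simp
  have eq: "(generator_term t y + c) * d = (ft t y + lam y * fy t y + \<sigma>\<^sup>2 * fyy t y / 2 + (\<sigma> * fy t y)\<^sup>2 / 2 + c) * d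
      + (lam y)\<^sup>2 / \<sigma>\<^sup>2 * d / 2" for t y c d
    by (simp add: generator_term_def field_simps)
  have eq': "(generator_term t y - c) * d = (ft t y + lam y * fy t y + \<sigma>\<^sup>2 * fyy t y / 2 + (\<sigma> * fy t y)\<^sup>2 / 2 - c) * d
      + (lam y)\<^sup>2 / \<sigma>\<^sup>2 * d / 2" for t y c d
    using eq[of t y "- c" d] by simp
  show ?case
    using log_tilt_increment
    by (rule eventually_mono) (simp only: Let_def eq eq' add.assoc[symmetric] add_le_cancel_right)
qed

text \<open>Summed over the grid, the upper inequality telescopes and bounds half the energy by a
  constant plus the logarithm of a tilted density. That density has expectation 1 for every mesh,
  and Fatou's lemma passes to the limit.\<close>

lemma finite_of_supersolution:
  assumes C: "\<And>t y. t \<in> {0..T} \<Longrightarrow> generator_term t y \<le> C"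
    and C': "\<And>y. - C' \<le> f T y"
  shows "novikov_half M lam \<sigma> X T < \<infinity>"
proof -
  define d where "d N = T / real N" for N
  \<comment> \<open>Steps beyond the horizon get coefficient 0, since the walk is indexed by all
    natural numbers while \<open>f\<close> is controlled on [0, T].\<close>
  define g where "g N k \<omega> = (if k < N then \<sigma> * fy (real k * d N) (X (real k * d N) \<omega>) else 0)" for N k \<omega>
  define h0 where "h0 N k \<omega> = \<sigma>\<^sup>2 * fyy (real k * d N) (X (real k * d N) \<omega>) + 1" for N k \<omega>
  \<comment> \<open>the cut-off of \<open>h\<close> is inactive along every path once the mesh is fine enough\<close>
  define h where "h N k \<omega> = (if k < N \<and> h0 N k \<omega> * d N \<le> 1 / 2 then h0 N k \<omega> else 0)" for N k \<omega>
  define D where "D N \<omega> = tilt_density W (g N) (h N) (d N) N \<omega>" for N \<omega>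
  define K where "K = exp (f 0 x + C' + (C + 3) * T)"
  have tw: "tilted_walk M F W (g N) (h N) (\<lambda>_ _. 0) (d N)" if N: "N > 0" for N
  proof
    show "d N > 0" using T_pos N by (simp add: d_def)
    fix k
    have *: "real k * d N \<in> {0..T}" if "k < N"
      using mesh_points[OF T_pos that] by (simp add: d_def algebra_simps)
    have m: "X (real k * d N) \<in> borel_measurable (F (real k * d N))"
      using \<open>d N > 0\<close> by (intro X_meas) auto
    show "g N k \<in> borel_measurable (F (real k * d N))"
      unfolding g_def using * measurable_compose[OF m fy_meas] by (cases "k < N") auto
    show "h N k \<in> borel_measurable (F (real k * d N))"
    proof (cases "k < N")
      case True
      have [measurable]: "h0 N k \<in> borel_measurable (F (real k * d N))"
        unfolding h0_def using measurable_compose[OF m fyy_meas[OF *[OF True]]] by auto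
      show ?thesis unfolding h_def by measurable
    qed (simp add: h_def[abs_def])
    show "h N k \<omega> * d N \<le> 1 / 2" for \<omega> by (simp add: h_def)
  qed (auto simp: bm)
  have D1: "(\<integral>\<^sup>+ \<omega>. ennreal (D N \<omega>) \<partial>M) = 1" and Dm: "D N \<in> borel_measurable M" for N
  proof -
    have "(\<integral>\<^sup>+ \<omega>. ennreal (D N \<omega>) \<partial>M) = 1 \<and> D N \<in> borel_measurable M"
    \<comment> \<open>For \<open>N = 0\<close> the product is empty, so its expectation is 1 as
      well.\<close>
    proof (cases "N = 0")
      case True
      then have "D N = (\<lambda>_. 1)" by (simp add: D_def fun_eq_iff)
      then show ?thesis
        using prob_space.emeasure_space_1[OF sbm_prob_space[OF bm]] by simp
    next
      case False
      then interpret tilted_walk M F W "g N" "h N" "\<lambda>_ _. 0" "d N" by (intro tw) simp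
      show ?thesis unfolding D_def[abs_def] using nn_integral_D D_meas_M by simp
    qed
    then show "(\<integral>\<^sup>+ \<omega>. ennreal (D N \<omega>) \<partial>M) = 1" "D N \<in> borel_measurable M" by auto
  qed
  have "AE \<omega> in M. ennreal (exp (1 / 2 * integral {0..T} (\<lambda>s. (lam (X s \<omega>))\<^sup>2 / \<sigma>\<^sup>2))) \<le>
      liminf (\<lambda>N. ennreal (K * D N \<omega>))"
    using AE_driven_path AE_energy_sum AE_increments
  proof eventually_elim
    case (elim \<omega>)
    then interpret driven_path f ft fy fyy T lam "\<lambda>t. X t \<omega>" "\<lambda>t. W t \<omega>" x \<sigma> by simp
    obtain R where R: "\<And>t. t \<in> {0..T} \<Longrightarrow> \<bar>X t \<omega>\<bar> \<le> R" using X_bounded by blast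
    obtain B where B: "B \<ge> 0" "\<And>t y. t \<in> {0..T} \<Longrightarrow> \<bar>y\<bar> \<le> R \<Longrightarrow> \<bar>fyy t y\<bar> \<le> B"
      using bounded_strip[OF fyy_cont] by metis
    have "(\<lambda>N. (\<sigma>\<^sup>2 * B + 1) * d N) \<longlonglongrightarrow> 0" unfolding d_def by real_asymp
    then have small: "\<forall>\<^sub>F N in sequentially. (\<sigma>\<^sup>2 * B + 1) * d N < 1 / 2" by (rule order_tendstoD) simp
    have "\<forall>\<^sub>F N in sequentially. ennreal (exp (1 / 2 * energy_sum N \<omega>)) \<le> ennreal (K * D N \<omega>)"
      using elim(3) small eventually_gt_at_top[of 0]
    proof eventually_elim
      case (elim N)
      let ?t = "\<lambda>k. real k * d N"
      have tT: "?t k \<in> {0..T}" if "k < N" for k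
        using mesh_points[OF T_pos that] by (simp add: d_def algebra_simps)
      have dN: "d N > 0" using elim T_pos by (simp add: d_def)
      have NT: "?t N = T" using elim by (simp add: d_def)
      have heq: "h N k \<omega> = \<sigma>\<^sup>2 * fyy (?t k) (X (?t k) \<omega>) + 1" "g N k \<omega> = \<sigma> * fy (?t k) (X (?t k) \<omega>)" if "k < N" for k
      proof -
        have "fyy (?t k) (X (?t k) \<omega>) \<le> B" using B(2)[OF tT[OF that] R[OF tT[OF that]]] by linarith
        then have "h0 N k \<omega> * d N \<le> (\<sigma>\<^sup>2 * B + 1) * d N"
          unfolding h0_def using dN by (intro mult_right_mono add_mono mult_left_mono) auto
        then show "h N k \<omega> = \<sigma>\<^sup>2 * fyy (?t k) (X (?t k) \<omega>) + 1" "g N k \<omega> = \<sigma> * fy (?t k) (X (?t k) \<omega>)"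
          using elim that by (auto simp: h_def h0_def g_def)
      qed
      have "(\<Sum>k<N. f (?t (Suc k)) (X (?t (Suc k)) \<omega>) - f (?t k) (X (?t k) \<omega>)
            + (lam (X (?t k) \<omega>))\<^sup>2 / \<sigma>\<^sup>2 * d N / 2)
          \<le> (\<Sum>k<N. log_tilt (g N k \<omega>) (h N k \<omega>) (d N) (W (?t (Suc k)) \<omega> - W (?t k) \<omega>) + (C + 3) * d N)"
      proof (intro sum_mono)
        fix k assume "k \<in> {..<N}"
        then have k: "k < N" by simp
        have "(generator_term (?t k) (X (?t k) \<omega>) + 3) * d N \<le> (C + 3) * d N"
          using C[OF tT[OF k]] dN by (intro mult_right_mono) auto
        then show "f (?t (Suc k)) (X (?t (Suc k)) \<omega>) - f (?t k) (X (?t k) \<omega>)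
            + (lam (X (?t k) \<omega>))\<^sup>2 / \<sigma>\<^sup>2 * d N / 2 \<le>
            log_tilt (g N k \<omega>) (h N k \<omega>) (d N) (W (?t (Suc k)) \<omega> - W (?t k) \<omega>) + (C + 3) * d N"
          using elim(1) k unfolding heq[OF k] Let_def d_def[symmetric] by fastforce
      qed
      moreover have "(\<Sum>k<N. (C + 3) * d N) = (C + 3) * T" using NT by simp
      moreover have "(\<Sum>k<N. f (?t (Suc k)) (X (?t (Suc k)) \<omega>) - f (?t k) (X (?t k) \<omega>)) = f T (X T \<omega>) - f 0 x"
        using \<open>driven_path f ft fy fyy T lam (\<lambda>t. X t \<omega>) (\<lambda>t. W t \<omega>) x \<sigma> \<and> X 0 \<omega> = x\<close> NT
        by (subst sum_lessThan_telescope) simp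
      moreover have "(\<Sum>k<N. (lam (X (?t k) \<omega>))\<^sup>2 / \<sigma>\<^sup>2 * d N / 2) = energy_sum N \<omega> / 2"
        by (simp add: energy_sum_def d_def sum_divide_distrib)
      ultimately have "energy_sum N \<omega> / 2 \<le> (f 0 x + C' + (C + 3) * T)
          + (\<Sum>k<N. log_tilt (g N k \<omega>) (h N k \<omega>) (d N) (W (?t (Suc k)) \<omega> - W (?t k) \<omega>))"
        using C'[of "X T \<omega>"] unfolding sum.distrib by linarith
      then have "exp (energy_sum N \<omega> / 2) \<le> K * D N \<omega>"
        unfolding K_def D_def tilt_density_def exp_add[symmetric] by simp
      then show ?case by (intro ennreal_leI) simp
    qed
    then have "liminf (\<lambda>N. ennreal (exp (1 / 2 * energy_sum N \<omega>))) \<le> liminf (\<lambda>N. ennreal (K * D N \<omega>))"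
      by (rule Liminf_mono)
    moreover have "(\<lambda>N. ennreal (exp (1 / 2 * energy_sum N \<omega>))) \<longlonglongrightarrow>
       ennreal (exp (1 / 2 * integral {0..T} (\<lambda>s. (lam (X s \<omega>))\<^sup>2 / \<sigma>\<^sup>2)))"
      using elim(2) by (intro tendsto_ennrealI tendsto_exp tendsto_mult tendsto_const)
    ultimately show ?case by (metis lim_imp_Liminf sequentially_bot)
  qed
  then have "novikov_half M lam \<sigma> X T \<le> (\<integral>\<^sup>+ \<omega>. liminf (\<lambda>N. ennreal (K * D N \<omega>)) \<partial>M)"
    unfolding novikov_half_def by (rule nn_integral_mono_AE)
  also have "\<dots> \<le> liminf (\<lambda>N. \<integral>\<^sup>+ \<omega>. ennreal (K * D N \<omega>) \<partial>M)"
    using Dm by (intro nn_integral_liminf) auto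
  also have "\<dots> = liminf (\<lambda>N. ennreal K)"
    using Dm D1 by (simp add: ennreal_mult' K_def nn_integral_cmult)
  also have "\<dots> < \<infinity>" by (simp add: Liminf_const)
  finally show ?thesis .
qed

end

section \<open>A lower bound from a tube\<close>

context sde_functional
begin

text \<open>Under the tilted law the drift is \<open>m'\<close>, so inside the tube the path is x +
  m plus \<open>\<sigma>\<close> times a martingale. The tilt is switched off at the first grid time
  outside the tube. The martingale has second moment at most 2 T, so
  \<open>r\<^sup>2 = 4 * T\<close> and Chebyshev's inequality cost half the mass; a truncation costs
  another quarter, which leaves the factor 1/4. The summand 1 in \<open>\<rho>\<close> pays for the
  discretisation.\<close>

lemma lower_bound_on_tube:
  fixes m m' \<Gamma> :: "real \<Rightarrow> real" and r A K :: real
  defines "\<rho> \<equiv> \<sigma> * (r + 1)"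
  assumes r: "r > 0" "r\<^sup>2 = 4 * T"
    and m'_cont: "continuous_on {0..T} m'"
    and m: "\<And>t. t \<in> {0..T} \<Longrightarrow> m t = integral {0..t} m'"
    and drift: "\<And>t y. t \<in> {0..T} \<Longrightarrow> \<sigma>\<^sup>2 * fy t y = m' t - lam y"
    and A: "\<And>y. \<bar>y - x - m T\<bar> \<le> \<rho> \<Longrightarrow> f T y - f 0 x \<le> A"
    and \<Gamma>_cont: "continuous_on {0..T} \<Gamma>"
    and \<Gamma>: "\<And>t y. t \<in> {0..T} \<Longrightarrow> \<bar>y - x - m t\<bar> \<le> \<rho> \<Longrightarrow> \<Gamma> t \<le> generator_term t y"
    and K: "K < integral {0..T} \<Gamma> - A - 3 * T"
  shows "novikov_half M lam \<sigma> X T \<ge> ennreal (exp K / 4)"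
proof -
  define d where "d N = T / real N" for N
  \<comment> \<open>The test covers all grid points up to \<open>k\<close>, so the event is known at
    time \<open>real k * d N\<close> and, once it fails, fails for all later indices.\<close>
  define tube where "tube N k \<omega> \<longleftrightarrow> (\<forall>j\<le>k. \<bar>X (real j * d N) \<omega> - x - m (real j * d N)\<bar> \<le> \<rho>)" for N k \<omega>
  define e where "e N k \<omega> = (if k < N \<and> tube N k \<omega> then 1 else 0 :: real)" for N k \<omega>
  define g where "g N k \<omega> = (if k < N \<and> tube N k \<omega> then \<sigma> * fy (real k * d N) (X (real k * d N) \<omega>) else 0)" for N k \<omega>
  define h where "h N k \<omega> = (if k < N \<and> tube N k \<omega> then \<sigma>\<^sup>2 * fyy (real k * d N) (X (real k * d N) \<omega>) - 1 else 0)" for N k \<omega>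
  define D where "D N \<omega> = tilt_density W (g N) (h N) (d N) N \<omega>" for N \<omega>
  define S where "S N \<omega> = compensated_sum W (g N) (e N) (d N) N \<omega>" for N \<omega>
  \<comment> \<open>A substitute for the indicator of |S| < r: the factor vanishes for |S| >= r and
    is at least 1 - S^2 / r^2, which builds Chebyshev's inequality in.\<close>
  define Y where "Y N \<omega> = D N \<omega> * max 0 (1 - (S N \<omega>)\<^sup>2 / r\<^sup>2)" for N \<omega>
  have \<rho>: "\<rho> > 0" using \<sigma>_pos r by (simp add: \<rho>_def)

  \<comment> \<open>Bounds on the path and the coefficients inside the tube\<close>
  have m_cont: "continuous_on {0..T} m"
    using indefinite_integral_continuous_1[OF integrable_continuous_real[OF m'_cont]]
    by (rule continuous_on_eq) (simp add: m)
  then have "compact (m ` {0..T})" by (intro compact_continuous_image) auto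
  then obtain Bm where Bm: "\<And>t. t \<in> {0..T} \<Longrightarrow> \<bar>m t\<bar> \<le> Bm"
    using compact_imp_bounded bounded_iff by (metis real_norm_def imageI)
  define R where "R = \<bar>x\<bar> + Bm + \<rho>"
  have tube_R: "\<bar>X (real k * d N) \<omega>\<bar> \<le> R" if "tube N k \<omega>" "real k * d N \<in> {0..T}" for N k \<omega>
    using that(1) Bm[OF that(2)] unfolding tube_def R_def by (fastforce dest: spec[of _ k])
  obtain B1 where B1: "B1 \<ge> 0" "\<And>t y. t \<in> {0..T} \<Longrightarrow> \<bar>y\<bar> \<le> R \<Longrightarrow> \<bar>fy t y\<bar> \<le> B1"
    using bounded_strip[OF fy_cont] by metis
  obtain B2 where B2: "B2 \<ge> 0" "\<And>t y. t \<in> {0..T} \<Longrightarrow> \<bar>y\<bar> \<le> R \<Longrightarrow> \<bar>fyy t y\<bar> \<le> B2"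
    using bounded_strip[OF fyy_cont] by metis
  define B where "B = \<sigma> * B1"
  define H where "H = \<sigma>\<^sup>2 * B2 + 1"
  have H: "H > 0" using B2(1) by (simp add: H_def add_nonneg_pos)
  have tT: "real k * d N \<in> {0..T}" if "k < N" for k N
    using mesh_points[OF T_pos that] by (simp add: d_def algebra_simps)
  have gB: "\<bar>g N k \<omega>\<bar> \<le> B" for N k \<omega>
    using B1 \<sigma>_pos tT[of k N] tube_R[of N k \<omega>] by (auto simp: g_def B_def abs_mult)
  have hH: "\<bar>h N k \<omega>\<bar> \<le> H" for N k \<omega>
  proof (cases "k < N \<and> tube N k \<omega>")
    case True
    then have "\<sigma>\<^sup>2 * \<bar>fyy (real k * d N) (X (real k * d N) \<omega>)\<bar> \<le> \<sigma>\<^sup>2 * B2"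
      using B2 tT[of k N] tube_R[of N k \<omega>] by (intro mult_left_mono) auto
    then have "\<bar>\<sigma>\<^sup>2 * fyy (real k * d N) (X (real k * d N) \<omega>)\<bar> \<le> \<sigma>\<^sup>2 * B2" by (simp add: abs_mult)
    then show ?thesis using True by (simp add: h_def H_def)
  qed (use H in \<open>auto simp: h_def\<close>)
  have "(\<lambda>N. H * d N) \<longlonglongrightarrow> 0" unfolding d_def by real_asymp
  then have "\<forall>\<^sub>F N in sequentially. H * d N < 1 / 4 \<and> N > 0"
    using eventually_gt_at_top by (intro eventually_conj order_tendstoD(2)) auto
  then obtain N0 where N0: "\<And>N. N \<ge> N0 \<Longrightarrow> H * d N < 1 / 4 \<and> N > 0"
    by (auto simp: eventually_sequentially)

  have tw: "tilted_walk M F W (g N) (h N) (e N) (d N)" if N: "N \<ge> N0" for N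
  proof
    show d: "d N > 0" using T_pos N0[OF N] by (simp add: d_def)
    fix k
    have m: "X (real j * d N) \<in> borel_measurable (F (real k * d N))" if "j \<le> k" for j
      using d that by (intro X_meas) (auto intro: mult_right_mono)
    have tube_meas [measurable]: "Measurable.pred (F (real k * d N)) (\<lambda>\<omega>. tube N k \<omega>)"
    proof -
      have "Measurable.pred (F (real k * d N)) (\<lambda>\<omega>. \<forall>j\<in>{..k}. \<bar>X (real j * d N) \<omega> - x - m (real j * d N)\<bar> \<le> \<rho>)"
      proof (rule pred_intros_finite)
        fix j assume "j \<in> {..k}"
        then have [measurable]: "X (real j * d N) \<in> borel_measurable (F (real k * d N))" by (intro m) simp
        show "Measurable.pred (F (real k * d N)) (\<lambda>\<omega>. \<bar>X (real j * d N) \<omega> - x - m (real j * d N)\<bar> \<le> \<rho>)"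
          unfolding pred_def
          by (intro borel_measurable_le borel_measurable_abs borel_measurable_diff borel_measurable_const) fact
      qed simp
      then show ?thesis unfolding tube_def by (simp only: Ball_def atMost_iff)
    qed
    show "g N k \<in> borel_measurable (F (real k * d N))" "h N k \<in> borel_measurable (F (real k * d N))"
    proof -
      have "g N k \<in> borel_measurable (F (real k * d N)) \<and> h N k \<in> borel_measurable (F (real k * d N))"
      proof (cases "k < N")
        case True
        have [measurable]: "(\<lambda>\<omega>. fy (real k * d N) (X (real k * d N) \<omega>)) \<in> borel_measurable (F (real k * d N))"
          "(\<lambda>\<omega>. fyy (real k * d N) (X (real k * d N) \<omega>)) \<in> borel_measurable (F (real k * d N))"
          using measurable_compose[OF m[OF order_refl] fy_meas[OF tT[OF True]]]
            measurable_compose[OF m[OF order_refl] fyy_meas[OF tT[OF True]]] by auto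
        show ?thesis unfolding g_def[abs_def] h_def[abs_def] by measurable
      qed (simp add: g_def[abs_def] h_def[abs_def])
      then show "g N k \<in> borel_measurable (F (real k * d N))" "h N k \<in> borel_measurable (F (real k * d N))" by auto
    qed
    show "e N k \<in> borel_measurable (F (real k * d N))"
      unfolding e_def[abs_def] by measurable
    show "h N k \<omega> * d N \<le> 1 / 2" for \<omega>
    proof -
      have "h N k \<omega> * d N \<le> H * d N" using hH[of N k \<omega>] d by (intro mult_right_mono) auto
      then show ?thesis using N0[OF N] by simp
    qed
  qed (rule bm)

  \<comment> \<open>Mass retained by the truncated tilted density\<close>
  define C where "C = exp ((H + 3 * B\<^sup>2) * T)"
  have C: "C > 0" by (simp add: C_def)
  \<comment> \<open>Truncation at \<open>4 * C\<close> gives the constant majorant for the reverse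
    Fatou lemma; since the second moment is at most \<open>C\<close>, it costs at most 1/4.\<close>
  define u where "u N \<omega> = (if N \<ge> N0 then min (Y N \<omega>) (4 * C) else 0)" for N \<omega>
  have u_meas [measurable]: "u N \<in> borel_measurable M" for N
  proof (cases "N \<ge> N0")
    case True
    then interpret tilted_walk M F W "g N" "h N" "e N" "d N" by (rule tw)
    have [measurable]: "D N \<in> borel_measurable M" "S N \<in> borel_measurable M"
      unfolding D_def[abs_def] S_def[abs_def] by (rule D_meas_M S_meas_M)+
    show ?thesis unfolding u_def[abs_def] Y_def[abs_def] by measurable
  qed (simp add: u_def[abs_def])
  have u_int: "(\<integral>\<^sup>+ \<omega>. ennreal (u N \<omega>) \<partial>M) \<ge> ennreal (1 / 4)" if N: "N \<ge> N0" for N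
  proof -
    interpret tilted_walk M F W "g N" "h N" "e N" "d N" by (rule tw[OF N])
    have NT: "d N * real N = T" using N0[OF N] by (simp add: d_def)
    have [measurable]: "D N \<in> borel_measurable M" "S N \<in> borel_measurable M"
      unfolding D_def[abs_def] S_def[abs_def] by (rule D_meas_M S_meas_M)+
    have 1: "(\<integral>\<^sup>+ \<omega>. ennreal (D N \<omega>) \<partial>M) = 1" unfolding D_def by (rule nn_integral_D)
    have 2: "(\<integral>\<^sup>+ \<omega>. ennreal ((D N \<omega>)\<^sup>2) \<partial>M) \<le> ennreal C"
      using nn_integral_D_squared[OF gB hH, of N] N0[OF N] unfolding C_def D_def NT by auto
    have 3: "(\<integral>\<^sup>+ \<omega>. ennreal (D N \<omega> * (S N \<omega>)\<^sup>2) \<partial>M) \<le> ennreal (2 * T)"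
      using nn_integral_D_S_squared[of N] unfolding D_def S_def
      by (simp add: e_def mult.assoc NT)
    \<comment> \<open>Where the truncation acts, D >= Y > 4 C, hence D <= D^2 / (4 C). The last two
      terms integrate to at most 1/4 and 2 T / r^2 = 1/2.\<close>
    have "D N \<omega> \<le> u N \<omega> + (D N \<omega>)\<^sup>2 / (4 * C) + D N \<omega> * (S N \<omega>)\<^sup>2 / r\<^sup>2" for \<omega>
    proof -
      have D0: "D N \<omega> \<ge> 0" by (simp add: D_def)
      have "D N \<omega> * (1 - (S N \<omega>)\<^sup>2 / r\<^sup>2) \<le> Y N \<omega>" unfolding Y_def using D0 by (intro mult_left_mono) auto
      moreover have "Y N \<omega> \<le> D N \<omega> * 1" unfolding Y_def using D0 by (intro mult_left_mono) auto
      moreover have "Y N \<omega> \<le> u N \<omega> + (D N \<omega>)\<^sup>2 / (4 * C)" if "Y N \<omega> \<le> D N \<omega>"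
      proof (cases "Y N \<omega> \<le> 4 * C")
        case True
        then show ?thesis using N C by (simp add: u_def)
      next
        case False
        then have "4 * C * D N \<omega> \<le> D N \<omega> * D N \<omega>" using that D0 by (intro mult_right_mono) auto
        then have "D N \<omega> \<le> (D N \<omega>)\<^sup>2 / (4 * C)" using C by (simp add: field_simps power2_eq_square)
        moreover have "u N \<omega> \<ge> 0" using C D0 by (simp add: u_def Y_def)
        ultimately show ?thesis using that by linarith
      qed
      ultimately show ?thesis by (simp add: algebra_simps)
    qed
    moreover have u0: "u N \<omega> \<ge> 0" for \<omega> using C by (simp add: u_def Y_def D_def)
    ultimately have "ennreal (D N \<omega>) \<le> ennreal (u N \<omega>) + ennreal (1 / (4 * C)) * ennreal ((D N \<omega>)\<^sup>2)
        + ennreal (1 / r\<^sup>2) * ennreal (D N \<omega> * (S N \<omega>)\<^sup>2)" for \<omega>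
      using C by (simp add: D_def ennreal_leI flip: ennreal_mult' ennreal_plus)
    then have "1 \<le> (\<integral>\<^sup>+ \<omega>. ennreal (u N \<omega>) + ennreal (1 / (4 * C)) * ennreal ((D N \<omega>)\<^sup>2)
        + ennreal (1 / r\<^sup>2) * ennreal (D N \<omega> * (S N \<omega>)\<^sup>2) \<partial>M)"
      unfolding 1[symmetric] by (intro nn_integral_mono) auto
    also have "\<dots> = (\<integral>\<^sup>+ \<omega>. ennreal (u N \<omega>) \<partial>M) + ennreal (1 / (4 * C)) * (\<integral>\<^sup>+ \<omega>. ennreal ((D N \<omega>)\<^sup>2) \<partial>M)
        + ennreal (1 / r\<^sup>2) * (\<integral>\<^sup>+ \<omega>. ennreal (D N \<omega> * (S N \<omega>)\<^sup>2) \<partial>M)"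
      by (simp add: nn_integral_add nn_integral_cmult)
    also have "\<dots> \<le> (\<integral>\<^sup>+ \<omega>. ennreal (u N \<omega>) \<partial>M) + ennreal (1 / (4 * C)) * ennreal C + ennreal (1 / r\<^sup>2) * ennreal (2 * T)"
      by (intro add_mono mult_left_mono order_refl 2 3) auto
    also have "\<dots> = (\<integral>\<^sup>+ \<omega>. ennreal (u N \<omega>) \<partial>M) + ennreal (3 / 4)"
    proof -
      have "ennreal (1 / (4 * C)) * ennreal C = ennreal (1 / 4)" "ennreal (1 / r\<^sup>2) * ennreal (2 * T) = ennreal (1 / 2)"
        using C T_pos r by (simp_all flip: ennreal_mult')
      moreover have "ennreal (1 / 4) + ennreal (1 / 2) = ennreal (3 / 4)"
        by (subst ennreal_plus[symmetric]) auto
      ultimately show ?thesis by (simp only: add.assoc)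
    qed
    finally have le: "1 \<le> (\<integral>\<^sup>+ \<omega>. ennreal (u N \<omega>) \<partial>M) + ennreal (3 / 4)" .
    have "ennreal (1 / 4) + ennreal (3 / 4) = 1"
      by (subst ennreal_plus[symmetric]) auto
    with le have "ennreal (3 / 4) + ennreal (1 / 4) \<le> ennreal (3 / 4) + (\<integral>\<^sup>+ \<omega>. ennreal (u N \<omega>) \<partial>M)"
      by (simp only: add.commute)
    then show ?thesis
      unfolding ennreal_add_left_cancel_le by (elim disjE) auto
  qed

  \<comment> \<open>Pathwise comparison with the energy, and the limit\<close>
  have "AE \<omega> in M. limsup (\<lambda>N. ennreal (exp K * u N \<omega>)) \<le>
      ennreal (exp (1 / 2 * integral {0..T} (\<lambda>s. (lam (X s \<omega>))\<^sup>2 / \<sigma>\<^sup>2)))"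
    using AE_driven_path AE_energy_sum AE_increments
  proof eventually_elim
    case (elim \<omega>)
    then interpret driven_path f ft fy fyy T lam "\<lambda>t. X t \<omega>" "\<lambda>t. W t \<omega>" x \<sigma> by simp
    have X0: "X 0 \<omega> = x" using elim by simp
    \<comment> \<open>Each step has two quadrature errors, from \<open>m'\<close> and from the
      drift; with this relative size they add up to at most \<open>\<sigma>\<close>, the margin
      contained in \<open>\<rho>\<close>.\<close>
    have eps: "\<sigma> / (2 * T) > 0" using \<sigma>_pos T_pos by simp
    have "K + A + 3 * T < integral {0..T} \<Gamma>" using K by simp
    with riemann_sum_tendsto[OF \<Gamma>_cont T_pos]
    have ev\<Gamma>: "\<forall>\<^sub>F N in sequentially. K + A + 3 * T < (\<Sum>k<N. \<Gamma> (real k * (T / real N)) * (T / real N))"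
      by (rule order_tendstoD)
    have "\<forall>\<^sub>F N in sequentially. ennreal (exp K * u N \<omega>) \<le> ennreal (exp (1 / 2 * energy_sum N \<omega>))"
      using elim(3) ev\<Gamma> mesh_integral[OF m'_cont T_pos eps] mesh_integral[OF lam_X_cont T_pos eps]
        eventually_ge_at_top[of N0]
    proof eventually_elim
      case (elim N)
      let ?t = "\<lambda>k. real k * d N"
      have N: "N > 0" using N0 elim by auto
      have dN: "d N > 0" using N T_pos by (simp add: d_def)
      have NT: "?t N = T" using N by (simp add: d_def)
      have tT': "?t k \<in> {0..T}" if "k \<le> N" for k
        using tT[of k N] that NT T_pos by (cases "k = N") auto
      show ?case
      proof (cases "tube N N \<omega>")
        case True
        \<comment> \<open>Inside the tube no coefficient has been switched off, so the lower
          inequality applies on every step and telescopes.\<close>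
        have tub: "tube N k \<omega>" if "k < N" for k using True that by (auto simp: tube_def)
        have "(\<Sum>k<N. log_tilt (g N k \<omega>) (h N k \<omega>) (d N) (W (?t (Suc k)) \<omega> - W (?t k) \<omega>) + (\<Gamma> (?t k) * d N - 3 * d N))
          \<le> (\<Sum>k<N. f (?t (Suc k)) (X (?t (Suc k)) \<omega>) - f (?t k) (X (?t k) \<omega>)
            + (lam (X (?t k) \<omega>))\<^sup>2 / \<sigma>\<^sup>2 * d N / 2)"
        proof (intro sum_mono)
          fix k assume "k \<in> {..<N}"
          then have k: "k < N" by simp
          have gh: "g N k \<omega> = \<sigma> * fy (?t k) (X (?t k) \<omega>)" "h N k \<omega> = \<sigma>\<^sup>2 * fyy (?t k) (X (?t k) \<omega>) - 1"
            using k tub[OF k] by (auto simp: g_def h_def)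
          have "\<Gamma> (?t k) \<le> generator_term (?t k) (X (?t k) \<omega>)"
            using tub[OF k] by (intro \<Gamma> tT[OF k]) (auto simp: tube_def)
          then have "(\<Gamma> (?t k) - 3) * d N \<le> (generator_term (?t k) (X (?t k) \<omega>) - 3) * d N"
            using dN by (intro mult_right_mono) auto
          then have "\<Gamma> (?t k) * d N - 3 * d N \<le> (generator_term (?t k) (X (?t k) \<omega>) - 3) * d N"
            by (simp only: left_diff_distrib)
          then show "log_tilt (g N k \<omega>) (h N k \<omega>) (d N) (W (?t (Suc k)) \<omega> - W (?t k) \<omega>) + (\<Gamma> (?t k) * d N - 3 * d N)
             \<le> f (?t (Suc k)) (X (?t (Suc k)) \<omega>) - f (?t k) (X (?t k) \<omega>) + (lam (X (?t k) \<omega>))\<^sup>2 / \<sigma>\<^sup>2 * d N / 2"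
            using elim(1) k unfolding gh Let_def d_def[symmetric] by fastforce
        qed
        moreover have "(\<Sum>k<N. 3 * d N) = 3 * T" using NT by simp
        moreover have "(\<Sum>k<N. f (?t (Suc k)) (X (?t (Suc k)) \<omega>) - f (?t k) (X (?t k) \<omega>)) = f T (X T \<omega>) - f 0 x"
          using X0 NT by (subst sum_lessThan_telescope) simp
        moreover have "(\<Sum>k<N. (lam (X (?t k) \<omega>))\<^sup>2 / \<sigma>\<^sup>2 * d N / 2) = energy_sum N \<omega> / 2"
          by (simp add: energy_sum_def d_def sum_divide_distrib)
        moreover have "f T (X T \<omega>) - f 0 x \<le> A"
          using True NT by (intro A) (auto simp: tube_def dest: spec[of _ N])
        moreover have "K + A + 3 * T < (\<Sum>k<N. \<Gamma> (?t k) * d N)" using elim by (simp add: d_def)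
        ultimately have "K + (\<Sum>k<N. log_tilt (g N k \<omega>) (h N k \<omega>) (d N) (W (?t (Suc k)) \<omega> - W (?t k) \<omega>)) \<le> energy_sum N \<omega> / 2"
          unfolding sum.distrib sum_subtractf by linarith
        then have "exp K * D N \<omega> \<le> exp (energy_sum N \<omega> / 2)"
          unfolding D_def tilt_density_def exp_add[symmetric] by simp
        moreover have "u N \<omega> \<le> D N \<omega> * 1"
        proof -
          have "u N \<omega> \<le> Y N \<omega>" using elim by (simp add: u_def)
          also have "\<dots> \<le> D N \<omega> * 1" unfolding Y_def by (intro mult_left_mono) (auto simp: D_def)
          finally show ?thesis .
        qed
        then have "exp K * u N \<omega> \<le> exp K * D N \<omega>" by (intro mult_left_mono) auto
        ultimately have "exp K * u N \<omega> \<le> exp (energy_sum N \<omega> / 2)" by (rule order_trans[rotated])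
        then show ?thesis by (intro ennreal_leI) simp
      next
        case False
        \<comment> \<open>Off the tube the weight has to vanish. At the first exit index
          \<open>k\<close> the deviation exceeds \<open>\<rho>\<close>; \<open>S\<close> has stopped
          there, and \<open>\<sigma> * S\<close> equals the deviation up to \<open>\<sigma>\<close>,
          which forces |S| >= r and \<open>Y = 0\<close>.\<close>
        define p where "p k \<longleftrightarrow> \<bar>X (?t k) \<omega> - x - m (?t k)\<bar> > \<rho>" for k
        obtain k where kN: "k \<le> N" and pk: "p k" and min: "\<And>j. j < k \<Longrightarrow> \<not> p j"
        proof -
          obtain k where k: "k \<le> N" "p k" using False by (auto simp: tube_def p_def not_le)
          have "(LEAST k. p k) \<le> k" using k by (intro Least_le)
          with k show ?thesis
            by (intro that[of "LEAST k. p k"]) (auto intro: LeastI dest: not_less_Least)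
        qed
        have tube_iff: "tube N j \<omega> \<longleftrightarrow> j < k" for j
          using min pk unfolding tube_def p_def not_less by (metis leD le_less_trans linorder_not_less order_refl not_le)
        have "S N \<omega> = (\<Sum>j<N. if j < k then W (?t (Suc j)) \<omega> - W (?t j) \<omega> - g N j \<omega> * d N else 0)"
          unfolding S_def compensated_sum_def by (intro sum.cong) (auto simp: e_def tube_iff)
        also have "\<dots> = (\<Sum>j<k. W (?t (Suc j)) \<omega> - W (?t j) \<omega> - g N j \<omega> * d N)"
          using kN by (subst sum.If_cases) (auto intro!: sum.cong)
        finally have "\<sigma> * S N \<omega> = (\<Sum>j<k. \<sigma> * (W (?t (Suc j)) \<omega> - W (?t j) \<omega> - g N j \<omega> * d N))"
          by (simp add: sum_distrib_left)
        moreover have "X (?t k) \<omega> - x - m (?t k) = (\<Sum>j<k. (X (?t (Suc j)) \<omega> - m (?t (Suc j))) - (X (?t j) \<omega> - m (?t j)))"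
          using X0 m[of 0] T_pos by (subst sum_lessThan_telescope) simp
        ultimately have "\<bar>(X (?t k) \<omega> - x - m (?t k)) - \<sigma> * S N \<omega>\<bar> =
            \<bar>\<Sum>j<k. ((X (?t (Suc j)) \<omega> - m (?t (Suc j))) - (X (?t j) \<omega> - m (?t j)))
               - \<sigma> * (W (?t (Suc j)) \<omega> - W (?t j) \<omega> - g N j \<omega> * d N)\<bar>"
          by (simp only: sum_subtractf)
        also have "\<dots> \<le> (\<Sum>j<k. \<bar>((X (?t (Suc j)) \<omega> - m (?t (Suc j))) - (X (?t j) \<omega> - m (?t j)))
               - \<sigma> * (W (?t (Suc j)) \<omega> - W (?t j) \<omega> - g N j \<omega> * d N)\<bar>)"
          by (rule sum_abs)
        also have "\<dots> \<le> (\<Sum>j<k. 2 * (\<sigma> / (2 * T) * d N))"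
        proof (rule sum_mono)
          fix j assume "j \<in> {..<k}"
          then have j: "j < k" "j < N" using kN by auto
          have 1: "X (?t i) \<omega> = x + integral {0..?t i} (\<lambda>s. lam (X s \<omega>)) + \<sigma> * W (?t i) \<omega>"
            "m (?t i) = integral {0..?t i} m'" if "i \<le> N" for i
            using X_eq m tT'[OF that] by auto
          have "\<sigma> * (g N j \<omega> * d N) = \<sigma>\<^sup>2 * fy (?t j) (X (?t j) \<omega>) * d N"
            using j by (simp add: g_def tube_iff power2_eq_square)
          also have "\<dots> = m' (?t j) * d N - lam (X (?t j) \<omega>) * d N"
            using drift[OF tT[OF j(2)]] by (simp add: left_diff_distrib)
          finally have g: "\<sigma> * (g N j \<omega> * d N) = m' (?t j) * d N - lam (X (?t j) \<omega>) * d N" .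
          have "((X (?t (Suc j)) \<omega> - m (?t (Suc j))) - (X (?t j) \<omega> - m (?t j)))
               - \<sigma> * (W (?t (Suc j)) \<omega> - W (?t j) \<omega> - g N j \<omega> * d N) =
             (integral {0..?t (Suc j)} (\<lambda>s. lam (X s \<omega>)) - integral {0..?t j} (\<lambda>s. lam (X s \<omega>)) - lam (X (?t j) \<omega>) * d N)
             - (integral {0..?t (Suc j)} m' - integral {0..?t j} m' - m' (?t j) * d N)"
            using 1[of j] 1[of "Suc j"] j g by (simp add: right_diff_distrib del: of_nat_Suc)
          moreover have "\<bar>integral {0..?t (Suc j)} m' - integral {0..?t j} m' - m' (?t j) * d N\<bar> \<le> \<sigma> / (2 * T) * d N"
            "\<bar>integral {0..?t (Suc j)} (\<lambda>s. lam (X s \<omega>)) - integral {0..?t j} (\<lambda>s. lam (X s \<omega>)) - lam (X (?t j) \<omega>) * d N\<bar>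
               \<le> \<sigma> / (2 * T) * d N"
            using elim(3,4) j unfolding d_def by auto
          ultimately show "\<bar>((X (?t (Suc j)) \<omega> - m (?t (Suc j))) - (X (?t j) \<omega> - m (?t j)))
               - \<sigma> * (W (?t (Suc j)) \<omega> - W (?t j) \<omega> - g N j \<omega> * d N)\<bar> \<le> 2 * (\<sigma> / (2 * T) * d N)"
            by linarith
        qed
        also have "\<dots> = real k * d N * \<sigma> / T" using T_pos by simp
        also have "\<dots> \<le> T * \<sigma> / T"
          using tT'[OF kN] \<sigma>_pos T_pos by (intro divide_right_mono mult_right_mono) auto
        also have "\<dots> = \<sigma>" using T_pos by simp
        finally have "\<bar>(X (?t k) \<omega> - x - m (?t k)) - \<sigma> * S N \<omega>\<bar> \<le> \<sigma>" .
        moreover have "\<bar>X (?t k) \<omega> - x - m (?t k)\<bar> > \<sigma> * r + \<sigma>"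
          using pk by (simp add: p_def \<rho>_def algebra_simps)
        ultimately have "\<sigma> * r \<le> \<bar>\<sigma> * S N \<omega>\<bar>" by linarith
        then have "r \<le> \<bar>S N \<omega>\<bar>" using \<sigma>_pos by (simp add: abs_mult)
        then have "r\<^sup>2 \<le> (S N \<omega>)\<^sup>2" using r by (metis abs_le_square_iff abs_of_pos)
        moreover have "r\<^sup>2 > 0" using r(1) by simp
        ultimately have "1 \<le> (S N \<omega>)\<^sup>2 / r\<^sup>2" by (simp only: le_divide_eq_1_pos)
        then have "Y N \<omega> = 0" by (simp add: Y_def)
        then show ?thesis using C by (simp add: u_def)
      qed
    qed
    then have "limsup (\<lambda>N. ennreal (exp K * u N \<omega>)) \<le> limsup (\<lambda>N. ennreal (exp (1 / 2 * energy_sum N \<omega>)))"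
      by (rule Limsup_mono)
    moreover have "(\<lambda>N. ennreal (exp (1 / 2 * energy_sum N \<omega>))) \<longlonglongrightarrow>
       ennreal (exp (1 / 2 * integral {0..T} (\<lambda>s. (lam (X s \<omega>))\<^sup>2 / \<sigma>\<^sup>2)))"
      using elim(2) by (intro tendsto_ennrealI tendsto_exp tendsto_mult tendsto_const)
    ultimately show ?case by (metis lim_imp_Limsup sequentially_bot)
  qed
  then have "(\<integral>\<^sup>+ \<omega>. limsup (\<lambda>N. ennreal (exp K * u N \<omega>)) \<partial>M) \<le> novikov_half M lam \<sigma> X T"
    unfolding novikov_half_def by (rule nn_integral_mono_AE)
  moreover have "limsup (\<lambda>N. \<integral>\<^sup>+ \<omega>. ennreal (exp K * u N \<omega>) \<partial>M) \<le> (\<integral>\<^sup>+ \<omega>. limsup (\<lambda>N. ennreal (exp K * u N \<omega>)) \<partial>M)"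
  proof (rule nn_integral_limsup[where w = "\<lambda>_. ennreal (exp K * (4 * C))"])
    show "AE \<omega> in M. ennreal (exp K * u N \<omega>) \<le> ennreal (exp K * (4 * C))" for N
      using C by (intro AE_I2 ennreal_leI mult_left_mono) (auto simp: u_def)
    show "(\<integral>\<^sup>+ \<omega>. ennreal (exp K * (4 * C)) \<partial>M) < \<infinity>"
      using prob_space.emeasure_space_1[OF sbm_prob_space[OF bm]] by simp
  qed auto
  moreover have "ennreal (exp K / 4) \<le> limsup (\<lambda>N. \<integral>\<^sup>+ \<omega>. ennreal (exp K * u N \<omega>) \<partial>M)"
  proof (rule le_Limsup)
    show "\<forall>\<^sub>F N in sequentially. ennreal (exp K / 4) \<le> (\<integral>\<^sup>+ \<omega>. ennreal (exp K * u N \<omega>) \<partial>M)"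
      using eventually_ge_at_top[of N0]
    proof eventually_elim
      case (elim N)
      have "ennreal (exp K / 4) = ennreal (exp K) * ennreal (1 / 4)" by (simp flip: ennreal_mult')
      also have "\<dots> \<le> ennreal (exp K) * (\<integral>\<^sup>+ \<omega>. ennreal (u N \<omega>) \<partial>M)"
        by (intro mult_left_mono u_int elim) auto
      also have "\<dots> = (\<integral>\<^sup>+ \<omega>. ennreal (exp K * u N \<omega>) \<partial>M)"
        by (simp add: ennreal_mult' nn_integral_cmult)
      finally show ?case .
    qed
  qed auto
  ultimately show ?thesis by (meson order_trans)
qed

end

section \<open>The potential and its quadratic perturbations\<close>

lemma class_D_derivative:
  assumes "lam \<in> class_D" and "q = (\<lambda>y. - deriv lam y)"
  shows "(lam has_real_derivative - q y) (at y)" and "continuous_on UNIV q"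
proof -
  obtain D where D: "\<And>y. (lam has_real_derivative D y) (at y)" "continuous_on UNIV D"
    using assms(1) by (auto simp: class_D_def C1_differentiable_on_def has_real_derivative_iff_has_vector_derivative)
  then have "q = (\<lambda>y. - D y)" using assms(2) by (auto simp: DERIV_imp_deriv)
  then show "(lam has_real_derivative - q y) (at y)" "continuous_on UNIV q"
    using D by (auto intro: continuous_intros)
qed

lemma antiderivative_exists:
  fixes lam :: "real \<Rightarrow> real"
  assumes "continuous_on UNIV lam"
  obtains L where "\<And>y. (L has_real_derivative lam y) (at y)"
proof -
  have "\<exists>L. \<forall>y::real. - \<infinity> < ereal y \<longrightarrow> ereal y < \<infinity> \<longrightarrow> (L has_vector_derivative lam y) (at y)"
    using assms by (intro einterval_antiderivative) (auto simp: continuous_on_eq_continuous_at)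
  then show ?thesis using that by (auto simp: has_real_derivative_iff_has_vector_derivative)
qed

text \<open>The limit governs both tails; continuity bounds the compact remainder, which
  \<open>C\<close> absorbs.\<close>

lemma quadratic_growth_bounds:
  fixes q :: "real \<Rightarrow> real"
  assumes q: "continuous_on UNIV q"
    and lim: "((\<lambda>y. q (\<theta> + y) / y\<^sup>2) \<longlongrightarrow> \<kappa>) at_infinity"
    and "\<kappa>1 < \<kappa>" "\<kappa> < \<kappa>2"
  obtains C where "C \<ge> 0" "\<And>y. \<kappa>1 * y\<^sup>2 - C \<le> q (\<theta> + y)" "\<And>y. q (\<theta> + y) \<le> \<kappa>2 * y\<^sup>2 + C"
proof -
  have "\<forall>\<^sub>F y in at_infinity. \<kappa>1 < q (\<theta> + y) / y\<^sup>2 \<and> q (\<theta> + y) / y\<^sup>2 < \<kappa>2"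
    using order_tendstoD[OF lim] assms by (intro eventually_conj) auto
  then obtain b where b: "\<And>y. \<bar>y\<bar> \<ge> b \<Longrightarrow> \<kappa>1 < q (\<theta> + y) / y\<^sup>2 \<and> q (\<theta> + y) / y\<^sup>2 < \<kappa>2"
    unfolding eventually_at_infinity by auto
  \<comment> \<open>The entry 1 keeps y nonzero outside the interval, so that the quotient can be
    cleared.\<close>
  define R where "R = max b 1"
  have "compact ((\<lambda>y. q (\<theta> + y) - \<kappa>1 * y\<^sup>2) ` {-R..R})" "compact ((\<lambda>y. q (\<theta> + y) - \<kappa>2 * y\<^sup>2) ` {-R..R})"
    by (intro compact_continuous_image continuous_intros continuous_on_compose2[OF q]; simp)+
  then obtain C1 C2 where C1: "\<And>y. y \<in> {-R..R} \<Longrightarrow> \<bar>q (\<theta> + y) - \<kappa>1 * y\<^sup>2\<bar> \<le> C1"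
    and C2: "\<And>y. y \<in> {-R..R} \<Longrightarrow> \<bar>q (\<theta> + y) - \<kappa>2 * y\<^sup>2\<bar> \<le> C2"
    by (metis (no_types, lifting) compact_imp_bounded bounded_iff real_norm_def imageI)
  have far: "\<kappa>1 * y\<^sup>2 \<le> q (\<theta> + y) \<and> q (\<theta> + y) \<le> \<kappa>2 * y\<^sup>2" if "y \<notin> {-R..R}" for y
  proof -
    have "\<bar>y\<bar> \<ge> b" "y \<noteq> 0" using that by (auto simp: R_def)
    then show ?thesis using b[of y] by (auto simp: field_simps)
  qed
  show ?thesis
  proof (rule that[of "max 0 (max C1 C2)"])
    fix y
    show "\<kappa>1 * y\<^sup>2 - max 0 (max C1 C2) \<le> q (\<theta> + y)" "q (\<theta> + y) \<le> \<kappa>2 * y\<^sup>2 + max 0 (max C1 C2)"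
      using C1[of y] C2[of y] far[of y] by (cases "y \<in> {-R..R}"; linarith)+
  qed simp
qed

lemma quartic_minus_quadratic_bounded_below:
  fixes k E y :: real
  assumes "k > 0"
  shows "k * y ^ 4 - E * y\<^sup>2 \<ge> - E\<^sup>2 / (4 * k)"
proof -
  have "0 \<le> (2 * k * y\<^sup>2 - E)\<^sup>2 / (4 * k)" using assms by simp
  also have "\<dots> = k * y ^ 4 - E * y\<^sup>2 + E\<^sup>2 / (4 * k)"
    using assms by (simp add: power2_eq_square power4_eq_xxxx field_simps)
  finally show ?thesis by simp
qed

text \<open>-L has second derivative \<open>q\<close>, which grows quadratically, so -L is at least
  k y^4 / 12 up to lower order terms, and a quartic beats every quadratic.\<close>

lemma potential_dominates_quadratic:
  fixes lam L q :: "real \<Rightarrow> real"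
  assumes L: "\<And>y. (L has_real_derivative lam y) (at y)"
    and lam: "\<And>y. (lam has_real_derivative - q y) (at y)" "lam \<theta> = 0"
    and q: "\<And>y. k * y\<^sup>2 - C \<le> q (\<theta> + y)" and k: "k > 0"
  obtains B where "\<And>y. E * y\<^sup>2 - B \<le> - L (\<theta> + y)"
proof -
  \<comment> \<open>Its second derivative q - k z^2 + C is nonnegative and its first derivative at 0
    vanishes because \<open>lam \<theta> = 0\<close>, so it is minimal at 0.\<close>
  define w where "w y = - L (\<theta> + y) - k * y ^ 4 / 12 + C * y\<^sup>2 / 2" for y
  have w: "w y \<ge> - L \<theta>" for y
  proof -
    have 1: "(w has_real_derivative - lam (\<theta> + z) - k * z ^ 3 / 3 + C * z) (at z)" for z
    proof -
      have "((\<lambda>z. L (\<theta> + z)) has_real_derivative lam (\<theta> + z) * 1) (at z)"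
        by (rule DERIV_chain2[OF L]) (auto intro!: derivative_eq_intros)
      then show ?thesis unfolding w_def[abs_def]
        by (auto intro!: derivative_eq_intros)
    qed
    have 2: "((\<lambda>z. - lam (\<theta> + z) - k * z ^ 3 / 3 + C * z) has_real_derivative q (\<theta> + z) - k * z\<^sup>2 + C) (at z)" for z
    proof -
      have "((\<lambda>z. lam (\<theta> + z)) has_real_derivative - q (\<theta> + z) * 1) (at z)"
        by (rule DERIV_chain2[OF lam(1)]) (auto intro!: derivative_eq_intros)
      then show ?thesis by (auto intro!: derivative_eq_intros)
    qed
    obtain c where c: "w y = w 0 + (- lam (\<theta> + 0) - k * 0 ^ 3 / 3 + C * 0) * (y - 0)
        + (q (\<theta> + c) - k * c\<^sup>2 + C) * (y - 0)\<^sup>2 / 2"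
      using taylor2_real[OF 1 2, of 0 y] by metis
    have "0 \<le> (q (\<theta> + c) - k * c\<^sup>2 + C) * y\<^sup>2" using q[of c] by (intro mult_nonneg_nonneg) auto
    then show ?thesis using c lam(2) by (simp add: w_def)
  qed
  show ?thesis
  proof (rule that)
    fix y
    show "E * y\<^sup>2 - ((E + C / 2)\<^sup>2 / (4 * (k / 12)) + L \<theta>) \<le> - L (\<theta> + y)"
      using w[of y] quartic_minus_quadratic_bounded_below[of "k / 12" "E + C / 2" y] k
      unfolding w_def by (simp add: distrib_right)
  qed
qed

text \<open>One family of test functions for both halves: finiteness takes c = 0 and a Riccati
  solution \<open>a\<close>, divergence takes a = 0 and a steering term \<open>c\<close>.\<close>

locale quadratic_ansatz =
  fixes lam L q a a' c c' :: "real \<Rightarrow> real" and \<theta> \<sigma> T :: real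
  assumes T: "T > 0" and \<sigma>: "\<sigma> > 0"
    and L: "\<And>y. (L has_real_derivative lam y) (at y)"
    and lam: "\<And>y. (lam has_real_derivative - q y) (at y)"
    and q_cont: "continuous_on UNIV q"
    and a: "\<And>t. t \<in> {0..T} \<Longrightarrow> (a has_real_derivative a' t) (at t within {0..T})"
    and c: "\<And>t. t \<in> {0..T} \<Longrightarrow> (c has_real_derivative c' t) (at t within {0..T})"
    and a'_cont: "continuous_on {0..T} a'"
    and c'_cont: "continuous_on {0..T} c'"
begin

definition "f t y = - L y / \<sigma>\<^sup>2 + a t * (y - \<theta>)\<^sup>2 / 2 + c t * (y - \<theta>)"
definition "ft t y = a' t * (y - \<theta>)\<^sup>2 / 2 + c' t * (y - \<theta>)"
definition "fy t y = - lam y / \<sigma>\<^sup>2 + a t * (y - \<theta>) + c t"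
definition "fyy t y = q y / \<sigma>\<^sup>2 + a t"

lemma lam_cont: "continuous_on UNIV lam"
  using lam by (intro continuous_at_imp_continuous_on) (auto intro: DERIV_isCont)

lemma a_cont: "continuous_on {0..T} a" and c_cont: "continuous_on {0..T} c"
  by (auto simp: continuous_on_eq_continuous_within intro!: DERIV_continuous[OF a] DERIV_continuous[OF c])

lemma space_time_function: "space_time_function f ft fy fyy T"
proof
  fix t y assume t: "t \<in> {0..T}"
  show "((\<lambda>t. f t y) has_real_derivative ft t y) (at t within {0..T})"
    unfolding f_def ft_def by (rule derivative_eq_intros a[OF t] c[OF t] refl | simp)+
  show "(f t has_real_derivative fy t y) (at y)"
    unfolding f_def[abs_def] fy_def using \<sigma>
    by (auto intro!: derivative_eq_intros L simp: field_simps power2_eq_square)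
  show "(fy t has_real_derivative fyy t y) (at y)"
    unfolding fy_def[abs_def] fyy_def using \<sigma>
    by (auto intro!: derivative_eq_intros lam simp: field_simps power2_eq_square)
next
  have fst: "continuous_on ({0..T} \<times> (UNIV :: real set)) (\<lambda>p. b (fst p))" if "continuous_on {0..T} b" for b :: "real \<Rightarrow> real"
    by (rule continuous_on_compose2[OF that]) (auto intro: continuous_intros)
  have snd: "continuous_on ({0..T} \<times> (UNIV :: real set)) (\<lambda>p. b (snd p))" if "continuous_on UNIV b" for b :: "real \<Rightarrow> real"
    by (rule continuous_on_compose2[OF that]) (auto intro: continuous_intros)
  show "continuous_on ({0..T} \<times> UNIV) (\<lambda>(t, y). ft t y)"
    unfolding ft_def case_prod_unfold by (intro continuous_intros fst a'_cont c'_cont) auto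
  show "continuous_on ({0..T} \<times> UNIV) (\<lambda>(t, y). fy t y)"
    unfolding fy_def case_prod_unfold using \<sigma>
    by (intro continuous_intros fst snd a_cont c_cont lam_cont) auto
  show "continuous_on ({0..T} \<times> UNIV) (\<lambda>(t, y). fyy t y)"
    unfolding fyy_def case_prod_unfold using \<sigma>
    by (intro continuous_intros fst snd a_cont q_cont) auto
qed (rule T)

lemma sde_functional:
  assumes "sde_solution M F W lam \<sigma> x X"
  shows "sde_functional f ft fy fyy T M F W X lam \<sigma> x"
  using space_time_function \<sigma> lam_cont assms
  by (simp add: sde_functional_def sde_functional_axioms_def)

text \<open>Completing the square: with fy = -lam / sigma^2 + b all terms in \<open>lam\<close>
  combine to sigma^2 b^2 / 2. Only \<open>q\<close> survives from the drift, and it competes with a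
  quadratic form.\<close>

lemma generator_term_eq:
  assumes "sde_solution M F W lam \<sigma> x X"
  shows "sde_functional.generator_term ft fy fyy lam \<sigma> t y =
     a' t * (y - \<theta>)\<^sup>2 / 2 + c' t * (y - \<theta>) + q y / 2 + \<sigma>\<^sup>2 * a t / 2 + \<sigma>\<^sup>2 * (a t * (y - \<theta>) + c t)\<^sup>2 / 2"
proof -
  interpret sde_functional f ft fy fyy T M F W X lam \<sigma> x by (rule sde_functional[OF assms])
  define b where "b = a t * (y - \<theta>) + c t"
  have fy: "fy t y = - lam y / \<sigma>\<^sup>2 + b" by (simp add: fy_def b_def)
  have "lam y * fy t y + (\<sigma> * fy t y)\<^sup>2 / 2 + (lam y)\<^sup>2 / (2 * \<sigma>\<^sup>2) = \<sigma>\<^sup>2 * b\<^sup>2 / 2"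
    unfolding fy using \<sigma> by (simp add: power2_eq_square field_simps)
  moreover have "\<sigma>\<^sup>2 * fyy t y / 2 = q y / 2 + \<sigma>\<^sup>2 * a t / 2"
    using \<sigma> by (simp add: fyy_def field_simps)
  ultimately show ?thesis
    unfolding generator_term_def b_def[symmetric] ft_def by linarith
qed

end

section \<open>The critical time\<close>

text \<open>For some k above kappa with k sigma^2 T^2 < pi^2 one has q (theta + y) <= k y^2 + C. A
  Riccati solution alive on all of [0, T] cancels this quadratic growth in the generator term, and
  the growth of -L bounds \<open>f T\<close> from below.\<close>

lemma novikov_finite:
  fixes lam q :: "real \<Rightarrow> real" and \<theta> \<sigma> \<kappa> x T :: real
  assumes D: "lam \<in> class_D" and eq: "lam \<theta> = 0" and q: "q = (\<lambda>y. - deriv lam y)" and \<sigma>: "\<sigma> > 0"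
    and lim: "((\<lambda>y. q (\<theta> + y) / y\<^sup>2) \<longlongrightarrow> \<kappa>) at_infinity"
    and \<kappa>: "\<kappa> > 0" and T: "T > 0" and sde: "sde_solution M F W lam \<sigma> x X"
    and sub: "\<kappa> * \<sigma>\<^sup>2 * T\<^sup>2 < pi\<^sup>2"
  shows "novikov_half M lam \<sigma> X T < \<infinity>"
proof -
  have lam': "\<And>y. (lam has_real_derivative - q y) (at y)" and q_cont: "continuous_on UNIV q"
    using class_D_derivative[OF D q] by auto
  have "continuous_on UNIV lam"
    using lam' by (intro continuous_at_imp_continuous_on) (auto intro: DERIV_isCont)
  then obtain L where L: "\<And>y. (L has_real_derivative lam y) (at y)" using antiderivative_exists by blast
  have sT: "\<sigma>\<^sup>2 * T\<^sup>2 > 0" using \<sigma> T by simp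
  have "\<kappa> < pi\<^sup>2 / (\<sigma>\<^sup>2 * T\<^sup>2)" using sub sT by (simp add: pos_less_divide_eq mult.assoc)
  then obtain k where k: "\<kappa> < k" "k < pi\<^sup>2 / (\<sigma>\<^sup>2 * T\<^sup>2)" by (blast dest: dense)
  define om where "om = \<sigma> * sqrt k"
  have om: "om > 0" "om\<^sup>2 = \<sigma>\<^sup>2 * k" using \<sigma> k \<kappa> by (auto simp: om_def power_mult_distrib)
  have "(om * T)\<^sup>2 < pi\<^sup>2"
    using k(2) sT by (simp add: om(2) power_mult_distrib pos_less_divide_eq mult_ac)
  then have omT: "om * T < pi" by (rule power2_less_imp_less) simp
  obtain C where C: "C \<ge> 0" "\<And>y. \<kappa> / 2 * y\<^sup>2 - C \<le> q (\<theta> + y)" "\<And>y. q (\<theta> + y) \<le> k * y\<^sup>2 + C"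
    using quadratic_growth_bounds[OF q_cont lim, of "\<kappa> / 2" k] \<kappa> k by auto

  \<comment> \<open>Centring at \<open>T / 2\<close> puts the argument of the tangent symmetrically
    inside (-pi / 2, pi / 2).\<close>
  have phase: "\<bar>om * (t - T / 2)\<bar> < pi / 2" if "t \<in> {0..T}" for t
  proof -
    have "\<bar>om * (t - T / 2)\<bar> = om * \<bar>t - T / 2\<bar>" using om by (simp add: abs_mult)
    also have "\<dots> \<le> om * (T / 2)"
    proof (rule mult_left_mono)
      show "\<bar>t - T / 2\<bar> \<le> T / 2" using that unfolding atLeastAtMost_iff by linarith
    qed (use om in simp)
    finally show ?thesis using omT by simp
  qed
  have cos: "cos (om * (t - T / 2)) > 0" if "t \<in> {0..T}" for t
    using phase[OF that] by (intro cos_gt_zero_pi) auto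
  text \<open>The Riccati solution of \<open>a' + \<sigma>\<^sup>2 a\<^sup>2 + k = 0\<close>; its life span \<open>pi / om\<close> exceeds \<open>T\<close>.\<close>
  define a where "a t = - (om / \<sigma>\<^sup>2) * tan (om * (t - T / 2))" for t
  define a' where "a' t = - (om\<^sup>2 / \<sigma>\<^sup>2) * inverse ((cos (om * (t - T / 2)))\<^sup>2)" for t
  have a_deriv: "(a has_real_derivative a' t) (at t within {0..T})" if "t \<in> {0..T}" for t
  proof -
    have "((\<lambda>t. tan (om * (t - T / 2))) has_real_derivative
        inverse ((cos (om * (t - T / 2)))\<^sup>2) * om) (at t within {0..T})"
      using cos[OF that]
      by (intro DERIV_chain2[OF DERIV_tan]) (auto intro!: derivative_eq_intros)
    from DERIV_cmult[OF this, of "- (om / \<sigma>\<^sup>2)"] show ?thesis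
      by (simp add: a_def[abs_def] a'_def power2_eq_square mult_ac)
  qed
  have a'_cont: "continuous_on {0..T} a'"
    unfolding a'_def[abs_def] using cos by (intro continuous_intros) (fastforce)+
  interpret A: quadratic_ansatz lam L q a a' "\<lambda>_. 0" "\<lambda>_. 0" \<theta> \<sigma> T
    using T \<sigma> L lam' q_cont a_deriv a'_cont by unfold_locales (auto intro: continuous_intros)
  interpret sde_functional A.f A.ft A.fy A.fyy T M F W X lam \<sigma> x
    by (rule A.sde_functional[OF sde])
  have riccati: "a' t + \<sigma>\<^sup>2 * (a t)\<^sup>2 = - k" if "t \<in> {0..T}" for t
  proof -
    define s c where "s = sin (om * (t - T / 2))" and "c = cos (om * (t - T / 2))"
    have c: "c \<noteq> 0" and sc: "s\<^sup>2 = 1 - c\<^sup>2"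
      using cos[OF that] by (auto simp: c_def s_def sin_squared_eq)
    have at: "a t = - (om / \<sigma>\<^sup>2) * (s / c)" by (simp add: a_def tan_def s_def c_def)
    have "\<sigma>\<^sup>2 * (a t)\<^sup>2 = om\<^sup>2 / \<sigma>\<^sup>2 * (s\<^sup>2 / c\<^sup>2)"
      unfolding at using \<sigma> c by (simp add: field_simps power2_eq_square)
    moreover have "a' t = - (om\<^sup>2 / \<sigma>\<^sup>2) * (1 / c\<^sup>2)"
      by (simp add: a'_def c_def inverse_eq_divide)
    moreover have "s\<^sup>2 / c\<^sup>2 = 1 / c\<^sup>2 - 1" using c sc by (simp add: diff_divide_distrib)
    ultimately have "a' t + \<sigma>\<^sup>2 * (a t)\<^sup>2 = - (om\<^sup>2 / \<sigma>\<^sup>2) * (1 / c\<^sup>2) + om\<^sup>2 / \<sigma>\<^sup>2 * (1 / c\<^sup>2 - 1)"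
      by (simp only:)
    also have "\<dots> = - (om\<^sup>2 / \<sigma>\<^sup>2)" by (simp only: right_diff_distrib)
    finally have "a' t + \<sigma>\<^sup>2 * (a t)\<^sup>2 = - (om\<^sup>2 / \<sigma>\<^sup>2)" .
    then show ?thesis using om \<sigma> by simp
  qed
  have "compact (a ` {0..T})" by (intro compact_continuous_image A.a_cont) simp
  then obtain Ba where Ba: "\<And>t. t \<in> {0..T} \<Longrightarrow> \<bar>a t\<bar> \<le> Ba"
    using compact_imp_bounded bounded_iff by (metis real_norm_def imageI)
  \<comment> \<open>Divided by \<open>\<sigma>\<^sup>2\<close>, this coefficient offsets the term a
    T (y - theta)^2 / 2 of \<open>f T\<close>; as a T is negative, -L has to outweigh it.\<close>
  obtain B where B: "\<And>y. (- a T * \<sigma>\<^sup>2 / 2) * y\<^sup>2 - B \<le> - L (\<theta> + y)"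
    using potential_dominates_quadratic[OF L lam' eq C(2)] \<kappa> by (metis half_gt_zero)
  show ?thesis
  proof (rule finite_of_supersolution)
    fix t y assume t: "t \<in> {0..T}"
    let ?z = "y - \<theta>"
    have "generator_term t y = (a' t + \<sigma>\<^sup>2 * (a t)\<^sup>2) * ?z\<^sup>2 / 2 + q y / 2 + \<sigma>\<^sup>2 * a t / 2"
      unfolding A.generator_term_eq[OF sde] by (simp add: field_simps power2_eq_square)
    also have "\<dots> = - k * ?z\<^sup>2 / 2 + q y / 2 + \<sigma>\<^sup>2 * a t / 2" unfolding riccati[OF t] ..
    also have "\<dots> \<le> C / 2 + \<sigma>\<^sup>2 * Ba / 2"
    proof -
      have "\<sigma>\<^sup>2 * a t \<le> \<sigma>\<^sup>2 * Ba" using Ba[OF t] by (intro mult_left_mono) auto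
      then show ?thesis using C(3)[of ?z] by simp
    qed
    finally show "generator_term t y \<le> C / 2 + \<sigma>\<^sup>2 * Ba / 2" .
  next
    fix y
    have "((- a T * \<sigma>\<^sup>2 / 2) * (y - \<theta>)\<^sup>2 - B) / \<sigma>\<^sup>2 \<le> - L y / \<sigma>\<^sup>2"
      using B[of "y - \<theta>"] by (intro divide_right_mono) auto
    moreover have "((- a T * \<sigma>\<^sup>2 / 2) * (y - \<theta>)\<^sup>2 - B) / \<sigma>\<^sup>2 = - (a T * (y - \<theta>)\<^sup>2 / 2) - B / \<sigma>\<^sup>2"
      using \<sigma> by (simp add: field_simps)
    ultimately show "- (B / \<sigma>\<^sup>2) \<le> A.f T y" unfolding A.f_def by simp
  qed
qed

lemma quadratic_unbounded:
  fixes g b c v :: real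
  assumes "g > 0"
  obtains n where "n \<ge> 1" "v \<le> n\<^sup>2 * g - n * b - c"
proof -
  obtain n where n: "n \<ge> 1" "n \<ge> (\<bar>b\<bar> + \<bar>c\<bar> + \<bar>v\<bar>) / g"
    using max.cobounded1 max.cobounded2 by blast
  then have "\<bar>c\<bar> + \<bar>v\<bar> \<le> n * g - b" using assms by (simp add: pos_divide_le_eq)
  then have "n * (\<bar>c\<bar> + \<bar>v\<bar>) \<le> n * (n * g - b)" using n by (intro mult_left_mono) auto
  moreover have "1 * (\<bar>c\<bar> + \<bar>v\<bar>) \<le> n * (\<bar>c\<bar> + \<bar>v\<bar>)" using n by (intro mult_right_mono) auto
  ultimately have "\<bar>c\<bar> + \<bar>v\<bar> \<le> n * (n * g - b)" by (metis mult_1 order_trans)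
  also have "\<dots> = n\<^sup>2 * g - n * b" by (simp add: power2_eq_square right_diff_distrib)
  finally have "v \<le> n\<^sup>2 * g - n * b - c" by linarith
  with n(1) show ?thesis by (rule that)
qed

text \<open>Let s = sin (pi t / T) and w = pi^2 / (sigma^2 T^2). Around the curve x + n s the
  generator term is at least n^2 (k s^2 / 2 - w s^2 + w (1 - s^2) / 2) - O(n), with time average n^2
  (k - w) / 4 - O(n). Since w < kappa, k can be taken above w; the end terms are O(n), so the lower
  bounds are unbounded in n.\<close>

lemma novikov_infinite:
  fixes lam q :: "real \<Rightarrow> real" and \<theta> \<sigma> \<kappa> x T :: real
  assumes D: "lam \<in> class_D" and q: "q = (\<lambda>y. - deriv lam y)" and \<sigma>: "\<sigma> > 0"
    and lim: "((\<lambda>y. q (\<theta> + y) / y\<^sup>2) \<longlongrightarrow> \<kappa>) at_infinity"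
    and T: "T > 0" and sde: "sde_solution M F W lam \<sigma> x X"
    and super: "\<kappa> * \<sigma>\<^sup>2 * T\<^sup>2 > pi\<^sup>2"
  shows "novikov_half M lam \<sigma> X T = \<infinity>"
proof -
  have lam': "\<And>y. (lam has_real_derivative - q y) (at y)" and q_cont: "continuous_on UNIV q"
    using class_D_derivative[OF D q] by auto
  have "continuous_on UNIV lam"
    using lam' by (intro continuous_at_imp_continuous_on) (auto intro: DERIV_isCont)
  then obtain L where L: "\<And>y. (L has_real_derivative lam y) (at y)" using antiderivative_exists by blast
  have sT: "\<sigma>\<^sup>2 * T\<^sup>2 > 0" using \<sigma> T by simp
  define w where "w = (pi / T)\<^sup>2 / \<sigma>\<^sup>2"
  have "w * (\<sigma>\<^sup>2 * T\<^sup>2) = pi\<^sup>2" using \<sigma> T by (simp add: w_def power_divide)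
  with super have "w * (\<sigma>\<^sup>2 * T\<^sup>2) < \<kappa> * (\<sigma>\<^sup>2 * T\<^sup>2)" by (simp add: mult.assoc)
  then have w: "w < \<kappa>" unfolding mult_less_cancel_right_pos[OF sT] .
  have w0: "w \<ge> 0" by (simp add: w_def)
  define k where "k = (\<kappa> + w) / 2"
  have k: "w < k" "k < \<kappa>" using w by (auto simp: k_def)
  obtain C where C: "C \<ge> 0" "\<And>y. k * y\<^sup>2 - C \<le> q (\<theta> + y)"
    using quadratic_growth_bounds[OF q_cont lim k(2), of "\<kappa> + 1"] by (metis less_add_one)
  define r where "r = 2 * sqrt T"
  have r: "r > 0" "r\<^sup>2 = 4 * T" using T by (auto simp: r_def power_mult_distrib)
  define \<rho> where "\<rho> = \<sigma> * (r + 1)"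
  \<comment> \<open>\<open>V\<close> bounds y - theta - m t in the tube, the part of the position
    that stays bounded as n grows.\<close>
  define V where "V = \<bar>x - \<theta>\<bar> + \<rho>"
  have \<rho>: "\<rho> > 0" using \<sigma> r by (simp add: \<rho>_def)
  have "compact (L ` {x - \<rho>..x + \<rho>})"
    using L by (intro compact_continuous_image continuous_at_imp_continuous_on) (auto intro: DERIV_isCont)
  then obtain BL where BL: "\<And>y. y \<in> {x - \<rho>..x + \<rho>} \<Longrightarrow> \<bar>L y\<bar> \<le> BL"
    using compact_imp_bounded bounded_iff by (metis real_norm_def imageI)
  \<comment> \<open>\<open>n * v\<close> is the size of the steering coefficient at both ends of the
    time interval, where the cosine is 1 and -1.\<close>
  define v where "v = pi / (T * \<sigma>\<^sup>2)"
  have v: "v > 0" using T \<sigma> by (simp add: v_def)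
  \<comment> \<open>By cos (2 phi) = 1 - 2 s^2 the coefficient of n^2 becomes G0 + G1 cos (2 phi):
    \<open>G0\<close> is its mean, and the oscillation integrates to zero over a full
    period.\<close>
  define G0 where "G0 = (k - w) / 4"
  define G1 where "G1 = (3 * w - k) / 4"
  define E1 where "E1 = w * V + k * V"
  define E2 where "E2 = C / 2"
  define A0 where "A0 = (BL + BL) / \<sigma>\<^sup>2"
  define A1 where "A1 = v * V + v * V"
  have G0: "G0 > 0" using k by (simp add: G0_def)

  have bound: "novikov_half M lam \<sigma> X T \<ge> ennreal (exp (n\<^sup>2 * (T * G0) - n * (T * E1 + A1) - (T * E2 + A0 + 3 * T + 1)) / 4)"
    if n: "n \<ge> 1" for n :: real
  proof -
    define \<phi> where "\<phi> t = pi / T * t" for t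
    define m where "m t = n * sin (\<phi> t)" for t
    define m' where "m' t = n * (pi / T) * cos (\<phi> t)" for t
    \<comment> \<open>This makes sigma^2 fy equal to m' - lam, so that the tilted drift is the
      velocity of the curve \<open>m\<close>.\<close>
    define c where "c t = m' t / \<sigma>\<^sup>2" for t
    define c' where "c' t = - (n * w * sin (\<phi> t))" for t
    have \<phi>: "(\<phi> has_real_derivative pi / T) (at t within S)" for t S
      using T unfolding \<phi>_def[abs_def] by (auto intro!: derivative_eq_intros)
    have \<phi>_cont: "continuous_on S \<phi>" for S
      unfolding \<phi>_def[abs_def] using T by (intro continuous_intros)
    have m_deriv: "(m has_real_derivative m' t) (at t within S)" for t S
      unfolding m_def[abs_def] m'_def by (auto intro!: derivative_eq_intros \<phi>)
    have c_deriv: "(c has_real_derivative c' t) (at t within S)" for t S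
      unfolding c_def[abs_def] m'_def[abs_def] c'_def w_def using \<sigma> T
      by (auto intro!: derivative_eq_intros \<phi> simp: power2_eq_square field_simps)
    have m'_cont: "continuous_on {0..T} m'" and c'_cont: "continuous_on {0..T} c'"
      unfolding m'_def[abs_def] c'_def[abs_def] by (intro continuous_intros \<phi>_cont)+
    \<comment> \<open>The curve returns to 0 at time \<open>T\<close>, so the end term only sees
      positions near \<open>x\<close> and grows linearly in \<open>n\<close>.\<close>
    have mT: "m T = 0" using T by (simp add: m_def \<phi>_def)
    have m_int: "m t = integral {0..t} m'" if "t \<in> {0..T}" for t
    proof -
      have "(m' has_integral m t - m 0) {0..t}"
        using that m_deriv by (intro fundamental_theorem_of_calculus)
          (auto simp flip: has_real_derivative_iff_has_vector_derivative)
      then show ?thesis by (simp add: m_def \<phi>_def integral_unique)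
    qed
    interpret A: quadratic_ansatz lam L q "\<lambda>_. 0" "\<lambda>_. 0" c c' \<theta> \<sigma> T
      using T \<sigma> L lam' q_cont c_deriv c'_cont by unfold_locales (auto intro: continuous_intros)
    interpret sde_functional A.f A.ft A.fy A.fyy T M F W X lam \<sigma> x
      by (rule A.sde_functional[OF sde])
    define \<Gamma> where "\<Gamma> t = n\<^sup>2 * (G0 + G1 * cos (2 * \<phi> t)) - n * E1 - E2" for t
    have \<Gamma>_cont: "continuous_on {0..T} \<Gamma>"
      unfolding \<Gamma>_def[abs_def] by (intro continuous_intros \<phi>_cont)
    have \<Gamma>_int: "integral {0..T} \<Gamma> = n\<^sup>2 * (T * G0) - n * (T * E1) - T * E2"
    proof -
      define P where "P t = n\<^sup>2 * (G0 * t + G1 * (sin (2 * \<phi> t) * (T / (2 * pi)))) - n * E1 * t - E2 * t" for t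
      have "(P has_real_derivative \<Gamma> t) (at t within {0..T})" for t
        unfolding P_def[abs_def] \<Gamma>_def using T by (auto intro!: derivative_eq_intros \<phi>)
      then have "(\<Gamma> has_integral P T - P 0) {0..T}"
        using T by (intro fundamental_theorem_of_calculus)
          (auto simp flip: has_real_derivative_iff_has_vector_derivative)
      moreover have "P 0 = 0" "P T = n\<^sup>2 * (T * G0) - n * (T * E1) - T * E2"
        using T by (simp_all add: P_def \<phi>_def algebra_simps)
      ultimately show ?thesis by (simp add: integral_unique)
    qed
    show ?thesis
    proof (rule lower_bound_on_tube[of r m' m "A0 + n * A1" \<Gamma>, folded \<rho>_def])
      show "r > 0" "r\<^sup>2 = 4 * T" by (fact r)+
      show "continuous_on {0..T} m'" "continuous_on {0..T} \<Gamma>" by (fact m'_cont \<Gamma>_cont)+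
      show "m t = integral {0..t} m'" if "t \<in> {0..T}" for t by (rule m_int[OF that])
      show "\<sigma>\<^sup>2 * A.fy t y = m' t - lam y" for t y
        using \<sigma> by (simp add: A.fy_def c_def field_simps)
      show "n\<^sup>2 * (T * G0) - n * (T * E1 + A1) - (T * E2 + A0 + 3 * T + 1) < integral {0..T} \<Gamma> - (A0 + n * A1) - 3 * T"
        unfolding \<Gamma>_int by (simp add: algebra_simps)
      show "A.f T y - A.f 0 x \<le> A0 + n * A1" if "\<bar>y - x - m T\<bar> \<le> \<rho>" for y
      proof -
        have y: "y \<in> {x - \<rho>..x + \<rho>}" "\<bar>y - \<theta>\<bar> \<le> V" using that by (auto simp: mT V_def)
        have x: "x \<in> {x - \<rho>..x + \<rho>}" "\<bar>x - \<theta>\<bar> \<le> V" using \<rho> by (auto simp: V_def)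
        have c: "c T = - (n * v)" "c 0 = n * v"
          using T by (auto simp: c_def m'_def \<phi>_def v_def)
        have "- L y / \<sigma>\<^sup>2 + L x / \<sigma>\<^sup>2 = (L x - L y) / \<sigma>\<^sup>2" by (simp add: diff_divide_distrib)
        also have "\<dots> \<le> A0" unfolding A0_def using BL[OF y(1)] BL[OF x(1)] by (intro divide_right_mono) auto
        finally have 1: "- L y / \<sigma>\<^sup>2 + L x / \<sigma>\<^sup>2 \<le> A0" .
        have nv: "n * v \<ge> 0" using n v by simp
        have "n * v * \<bar>y - \<theta>\<bar> \<le> n * v * V" "n * v * \<bar>x - \<theta>\<bar> \<le> n * v * V"
          using nv y x by (auto intro!: mult_left_mono)
        moreover have "- (n * v * z) \<le> n * v * \<bar>z\<bar>" for z
        proof -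
          have "n * v * - z \<le> n * v * \<bar>z\<bar>" using nv by (intro mult_left_mono) auto
          then show ?thesis by simp
        qed
        note this[of "y - \<theta>"] this[of "x - \<theta>"]
        moreover have "n * A1 = n * v * V + n * v * V" by (simp add: A1_def distrib_left)
        moreover have "- (n * v) * (y - \<theta>) = - (n * v * (y - \<theta>))" by simp
        moreover have "A.f T y - A.f 0 x = (- L y / \<sigma>\<^sup>2 + L x / \<sigma>\<^sup>2) + - (n * v) * (y - \<theta>) - n * v * (x - \<theta>)"
          unfolding A.f_def c by simp
        ultimately show ?thesis using 1 by linarith
      qed
      show "\<Gamma> t \<le> generator_term t y" if t: "t \<in> {0..T}" and tube: "\<bar>y - x - m t\<bar> \<le> \<rho>" for t y
      proof -
        define s where "s = sin (\<phi> t)"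
        \<comment> \<open>The position relative to theta is the oscillation n s plus the bounded
          remainder \<open>u\<close>; the mixed terms in s u go into \<open>E1\<close>.\<close>
        define u where "u = y - \<theta> - m t"
        have z: "y - \<theta> = n * s + u" by (simp add: u_def m_def s_def)
        have u: "\<bar>u\<bar> \<le> V" using tube unfolding u_def V_def by linarith
        have s: "\<bar>s\<bar> \<le> 1" by (simp add: s_def)
        have su: "\<bar>s * u\<bar> \<le> V" using mult_mono[OF s u] by (simp add: abs_mult)
        have q: "k * (n * s + u)\<^sup>2 - C \<le> q y" using C(2)[of "y - \<theta>"] unfolding z[symmetric] by simp
        have s2: "1 - s\<^sup>2 = (cos (\<phi> t))\<^sup>2" by (simp add: s_def cos_squared_eq)
        have cs: "\<sigma>\<^sup>2 * (c t)\<^sup>2 = n\<^sup>2 * w * (1 - s\<^sup>2)"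
          unfolding s2 using \<sigma> T by (simp add: c_def m'_def w_def power2_eq_square field_simps)
        have gen: "generator_term t y = - (n * w * s) * (n * s + u) + q y / 2 + n\<^sup>2 * w * (1 - s\<^sup>2) / 2"
          unfolding A.generator_term_eq[OF sde] z by (simp add: c'_def s_def cs)
        have c2: "cos (2 * \<phi> t) = 1 - 2 * s\<^sup>2" by (simp add: s_def cos_double_sin)
        have "\<Gamma> t = n\<^sup>2 * ((k / 2 - w) * s\<^sup>2 + w * (1 - s\<^sup>2) / 2) - n * E1 - E2"
          unfolding \<Gamma>_def c2 G0_def G1_def by (simp add: field_simps)
        moreover have "n * w * (s * u) \<le> n * w * V" "- (n * k * (s * u)) \<le> n * k * V"
        proof -
          have "n * w \<ge> 0" "n * k \<ge> 0" using n w0 k by auto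
          then show "n * w * (s * u) \<le> n * w * V" using su by (intro mult_left_mono) auto
          have "n * k * (- (s * u)) \<le> n * k * V" using \<open>n * k \<ge> 0\<close> su by (intro mult_left_mono) auto
          then show "- (n * k * (s * u)) \<le> n * k * V" by simp
        qed
        moreover have "k * u\<^sup>2 \<ge> 0" using w0 k by simp
        ultimately show ?thesis
          using q unfolding gen E1_def E2_def by (simp add: power2_eq_square algebra_simps)
      qed
    qed
  qed
  show ?thesis
  proof (rule ccontr)
    assume "novikov_half M lam \<sigma> X T \<noteq> \<infinity>"
    then obtain B where B: "B \<ge> 0" "novikov_half M lam \<sigma> X T = ennreal B"
      by (cases "novikov_half M lam \<sigma> X T") auto
    \<comment> \<open>The target 4 B is large enough, as exp (4 B) / 4 >= (1 + 4 B) / 4 > B.\<close>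
    obtain n where n: "n \<ge> 1" "4 * B \<le> n\<^sup>2 * (T * G0) - n * (T * E1 + A1) - (T * E2 + A0 + 3 * T + 1)"
      using quadratic_unbounded[of "T * G0" "4 * B"] T G0 by auto
    have "exp (4 * B) / 4 \<le> exp (n\<^sup>2 * (T * G0) - n * (T * E1 + A1) - (T * E2 + A0 + 3 * T + 1)) / 4"
      using n(2) by simp
    then have "ennreal (exp (4 * B) / 4) \<le> ennreal B"
      using bound[OF n(1)] B(2) by (metis ennreal_leI order_trans)
    then have "exp (4 * B) / 4 \<le> B" using B(1) by (simp add: ennreal_le_iff)
    moreover have "1 + 4 * B \<le> exp (4 * B)" by (rule exp_ge_add_one_self)
    ultimately show False by linarith
  qed
qed

theorem theorem4p4:
  fixes lam q :: "real \<Rightarrow> real" and \<theta> \<sigma> \<kappa> x T :: real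
    and M :: "'a measure" and F :: "real \<Rightarrow> 'a measure"
    and W X :: "real \<Rightarrow> 'a \<Rightarrow> real"
  assumes "lam \<in> class_D"
    and "equilibrium lam \<theta>"
    and "q = (\<lambda>y. - deriv lam y)"
    and "\<sigma> > 0"
    and "((\<lambda>y. q (\<theta> + y) / y\<^sup>2) \<longlongrightarrow> \<kappa>) at_infinity"
    and "\<kappa> > 0"
    and "T > 0"
    and "sde_solution M F W lam \<sigma> x X"
  shows "(\<kappa> * \<sigma>\<^sup>2 * T\<^sup>2 < pi\<^sup>2 \<longrightarrow> novikov_half M lam \<sigma> X T < \<infinity>) \<and>
         (\<kappa> * \<sigma>\<^sup>2 * T\<^sup>2 > pi\<^sup>2 \<longrightarrow> novikov_half M lam \<sigma> X T = \<infinity>)"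
proof (intro conjI impI)
  have eq: "lam \<theta> = 0" using assms(2) by (simp add: equilibrium_def)
  show "novikov_half M lam \<sigma> X T < \<infinity>" if "\<kappa> * \<sigma>\<^sup>2 * T\<^sup>2 < pi\<^sup>2"
    by (rule novikov_finite[OF assms(1) eq assms(3-8) that])
  show "novikov_half M lam \<sigma> X T = \<infinity>" if "\<kappa> * \<sigma>\<^sup>2 * T\<^sup>2 > pi\<^sup>2"
    by (rule novikov_infinite[OF assms(1,3,4,5,7,8) that])
qed

end
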